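(* Let $T$ be a completely non unitary contraction on a separable complex Hilbert space $\mathcal{H}$ whose characteristic function is a polynomial of degree $n$. Let $\mathcal{H}_1\oplus\mathcal{H}_0\oplus\mathcal{H}_{-1}$ and $\mathcal{H}_{1*}\oplus\mathcal{H}_{0*}\oplus\mathcal{H}_{-1*}$ be the decompositions of $\mathcal{H}$ for the canonical and the $*$-canonical representations of $T$, let $\mathcal{M}_1$ (respectively $\mathcal{M}_{-1}$) be the maximal invariant subspace of $T$ (respectively $T^*$) on which $T$ (respectively $T^*$) is isometric, and put $$\mathcal{H}_{00}=\mathcal{H}_0\ominus(\mathcal{M}_1\cap\mathcal{H}_0),\qquad \mathcal{H}_{0*0}=\mathcal{H}_{0*}\ominus(\mathcal{H}_{0*}\cap\mathcal{M}_{-1}).$$ Then the nilpotent operators $N_0=P_{\mathcal{H}_{00}}T|_{\mathcal{H}_{00}}$ and $N_{*0}=P_{\mathcal{H}_{0*0}}T|_{\mathcal{H}_{0*0}}$ are quasi-similar.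
   Context: A contraction $T$ is completely non unitary if there is no nonzero $T$-reducing subspace on which $T$ is unitary. Put $D_T=(I-T^*T)^{1/2}$, $D_{T^*}=(I-TT^* )^{1/2}$, $\mathcal{D}_T=\overline{\mathrm{Ran}\,D_T}$, $\mathcal{D}_{T^*}=\overline{\mathrm{Ran}\,D_{T^*}}$. The characteristic function of $T$ is $\Theta_T(z)=[-T+zD_{T^*}(I-zT^* )^{-1}D_T]|_{\mathcal{D}_T}\in\mathcal{L}(\mathcal{D}_T,\mathcal{D}_{T^*})$, $z\in\mathbb{D}$ (constants, including $0$, have degree $0$). $P_{\mathcal{K}}$ is the orthogonal projection onto $\mathcal{K}$. The canonical decomposition $\mathcal{H}=\mathcal{H}_1\oplus\mathcal{H}_0\oplus\mathcal{H}_{-1}$ is given by $\mathcal{H}_1=\overline{\mathrm{span}}\{T^kh: h\in\mathcal{D}_{T^*},k\ge n\}$, $\mathcal{H}_{-1}=\mathcal{M}_{-1}=\{h:\|T^{*(k+1)}h\|=\|T^{*k}h\|,\ k\ge0\}$, $\mathcal{H}_0=\mathcal{H}\ominus(\mathcal{H}_1\oplus\mathcal{H}_{-1})$. The $*$-canonical decomposition $\mathcal{H}=\mathcal{H}_{1*}\oplus\mathcal{H}_{0*}\oplus\mathcal{H}_{-1*}$ is given by $\mathcal{H}_{1*}=\mathcal{M}_1=\{h:\|T^{k+1}h\|=\|T^kh\|,\ k\ge0\}$, $\mathcal{H}_{-1*}=\overline{\mathrm{span}}\{T^{*k}h:h\in\mathcal{D}_T,k\ge n\}$, $\mathcal{H}_{0*}=\mathcal{H}\ominus(\mathcal{H}_{1*}\oplus\mathcal{H}_{-1*})$.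 In each of them $T$ is block upper triangular with diagonal entries a unilateral shift, a nilpotent operator of order $n$, and the adjoint of a unilateral shift. The operators $N_0$ and $N_{*0}$ are the central diagonal entries of the modified block upper triangular representations of $T$ on $\mathcal{H}=\mathcal{H}_{10}\oplus\mathcal{H}_{00}\oplus\mathcal{H}_{-10}$ and $\mathcal{H}=\mathcal{H}_{1*0}\oplus\mathcal{H}_{0*0}\oplus\mathcal{H}_{-1*0}$, where $\mathcal{H}_{10}=\mathcal{H}_1\oplus(\mathcal{M}_1\cap\mathcal{H}_0)$, $\mathcal{H}_{-10}=\mathcal{H}_{-1}$, $\mathcal{H}_{1*0}=\mathcal{H}_{1*}$, $\mathcal{H}_{-1*0}=\mathcal{H}_{-1*}\oplus(\mathcal{H}_{0*}\cap\mathcal{M}_{-1})$. Two operators $A\in\mathcal{L}(\mathcal{K}_1)$, $B\in\mathcal{L}(\mathcal{K}_2)$ are quasi-similar if there are bounded injective operators with dense range $X:\mathcal{K}_1\to\mathcal{K}_2$ and $Y:\mathcal{K}_2\to\mathcal{K}_1$ with $XA=BX$ and $YB=AY$. *)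

theory Defs
  imports "HOL-Analysis.Analysis"
begin

text \<open>
  A complex inner product space is a real inner product space, whose norm and topology are reused,
  together with a complex scalar multiplication and a complex inner product that is linear in its
  first argument and has the given real inner product as real part. In particular the square of
  the norm of \<open>x\<close> is \<open>cinner x x\<close>.
\<close>

class complex_inner = real_inner +
  fixes scaleC :: "complex \<Rightarrow> 'a \<Rightarrow> 'a"  (infixr \<open>*\<^sub>C\<close> 75)
    and cinner :: "'a \<Rightarrow> 'a \<Rightarrow> complex"
  assumes scaleC_add_right: "c *\<^sub>C (x + y) = c *\<^sub>C x + c *\<^sub>C y"
    and scaleC_add_left: "(c + d) *\<^sub>C x = c *\<^sub>C x + d *\<^sub>C x"
    and scaleC_scaleC: "c *\<^sub>C (d *\<^sub>C x) = (c * d) *\<^sub>C x"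
    and scaleC_of_real: "complex_of_real r *\<^sub>C x = r *\<^sub>R x"
    and cinner_add_left: "cinner (x + y) z = cinner x z + cinner y z"
    and cinner_scaleC_left: "cinner (c *\<^sub>C x) y = c * cinner x y"
    and cinner_commute: "cinner x y = cnj (cinner y x)"
    and Re_cinner: "Re (cinner x y) = x \<bullet> y"

class complex_hilbert = complex_inner + complete_space

global_interpretation complex_vector:
  vector_space "scaleC :: complex \<Rightarrow> 'a \<Rightarrow> 'a::complex_inner"
proof
  show "1 *\<^sub>C x = x" for x :: 'a
    using scaleC_of_real[of 1 x] by simp
qed (simp_all add: scaleC_add_right scaleC_add_left scaleC_scaleC)

instantiation complex :: complex_hilbert
begin

definition scaleC_complex :: "complex \<Rightarrow> complex \<Rightarrow> complex"
  where "scaleC_complex c x = c * x"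

definition cinner_complex :: "complex \<Rightarrow> complex \<Rightarrow> complex"
  where "cinner_complex x y = x * cnj y"

instance
  by standard
    (simp_all add: scaleC_complex_def cinner_complex_def algebra_simps scaleR_conv_of_real
      inner_complex_def)

end

definition closed_csubspace :: "'a::complex_inner set \<Rightarrow> bool"
  where "closed_csubspace M \<longleftrightarrow> complex_vector.subspace M \<and> closed M"

definition orth_diff :: "'a::complex_inner set \<Rightarrow> 'a set \<Rightarrow> 'a set"  (infixl \<open>\<ominus>\<close> 65)
  where "K \<ominus> L = {x \<in> K. \<forall>y\<in>L. cinner x y = 0}"

definition orth_proj :: "'a::complex_inner set \<Rightarrow> 'a \<Rightarrow> 'a"
  where "orth_proj K x = (THE y. y \<in> K \<and> x - y \<in> UNIV \<ominus> K)"

text \<open>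
  An operator between closed subspaces is a function on the ambient type; only its values on the
  domain subspace are relevant.
\<close>

definition bounded_operator ::
    "'a::complex_inner set \<Rightarrow> 'b::complex_inner set \<Rightarrow> ('a \<Rightarrow> 'b) \<Rightarrow> bool"
  where "bounded_operator K L A \<longleftrightarrow>
    A ` K \<subseteq> L \<and>
    (\<forall>x\<in>K. \<forall>y\<in>K. A (x + y) = A x + A y) \<and>
    (\<forall>c. \<forall>x\<in>K. A (c *\<^sub>C x) = c *\<^sub>C A x) \<and>
    (\<exists>C. \<forall>x\<in>K. norm (A x) \<le> C * norm x)"

definition contraction :: "('a::complex_inner \<Rightarrow> 'a) \<Rightarrow> bool"
  where "contraction T \<longleftrightarrow> bounded_operator UNIV UNIV T \<and> (\<forall>h. norm (T h) \<le> norm h)"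

definition cadjoint :: "('a::complex_inner \<Rightarrow> 'a) \<Rightarrow> 'a \<Rightarrow> 'a"
  where "cadjoint T = (THE S. \<forall>x y. cinner (T x) y = cinner x (S y))"

definition positive_operator :: "('a::complex_inner \<Rightarrow> 'a) \<Rightarrow> bool"
  where "positive_operator A \<longleftrightarrow>
    bounded_operator UNIV UNIV A \<and> (\<forall>x. cinner (A x) x \<in> \<real>\<^sub>\<ge>\<^sub>0)"

definition op_sqrt :: "('a::complex_inner \<Rightarrow> 'a) \<Rightarrow> 'a \<Rightarrow> 'a"
  where "op_sqrt A = (THE B. positive_operator B \<and> B \<circ> B = A)"

definition completely_non_unitary :: "('a::complex_inner \<Rightarrow> 'a) \<Rightarrow> bool"
  where "completely_non_unitary T \<longleftrightarrow>
    \<not> (\<exists>M. closed_csubspace M \<and> M \<noteq> {0} \<and>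
         T ` M \<subseteq> M \<and> cadjoint T ` M \<subseteq> M \<and>
         T ` M = M \<and> (\<forall>h\<in>M. norm (T h) = norm h))"

definition defect :: "('a::complex_inner \<Rightarrow> 'a) \<Rightarrow> 'a \<Rightarrow> 'a"
  where "defect T = op_sqrt (\<lambda>h. h - cadjoint T (T h))"

definition defect_star :: "('a::complex_inner \<Rightarrow> 'a) \<Rightarrow> 'a \<Rightarrow> 'a"
  where "defect_star T = op_sqrt (\<lambda>h. h - T (cadjoint T h))"

definition defect_space :: "('a::complex_inner \<Rightarrow> 'a) \<Rightarrow> 'a set"
  where "defect_space T = closure (range (defect T))"

definition defect_star_space :: "('a::complex_inner \<Rightarrow> 'a) \<Rightarrow> 'a set"
  where "defect_star_space T = closure (range (defect_star T))"

text \<open>The characteristic function; only its values on \<open>defect_space T\<close> are meant.\<close>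

definition char_fun :: "('a::complex_inner \<Rightarrow> 'a) \<Rightarrow> complex \<Rightarrow> 'a \<Rightarrow> 'a"
  where "char_fun T z h =
    - T h + z *\<^sub>C defect_star T (inv (\<lambda>g. g - z *\<^sub>C cadjoint T g) (defect T h))"

text \<open>
  \<open>F\<close> is on the unit disc a polynomial of degree \<open>n\<close> with coefficients in the bounded operators
  from \<open>K\<close> to \<open>L\<close>. Every constant, including \<open>0\<close>, has degree \<open>0\<close>.
\<close>

definition operator_polynomial ::
    "'a::complex_inner set \<Rightarrow> 'b::complex_inner set \<Rightarrow> nat \<Rightarrow> (complex \<Rightarrow> 'a \<Rightarrow> 'b) \<Rightarrow> bool"
  where "operator_polynomial K L n F \<longleftrightarrow>
    (\<exists>A :: nat \<Rightarrow> 'a \<Rightarrow> 'b.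
       (\<forall>k\<le>n. bounded_operator K L (A k)) \<and>
       (n > 0 \<longrightarrow> (\<exists>h\<in>K. A n h \<noteq> 0)) \<and>
       (\<forall>z\<in>ball 0 1. \<forall>h\<in>K. F z h = (\<Sum>k\<le>n. z ^ k *\<^sub>C A k h)))"

definition isometric_part :: "('a::complex_inner \<Rightarrow> 'a) \<Rightarrow> 'a set"
  where "isometric_part T = {h. \<forall>k. norm ((T ^^ (k + 1)) h) = norm ((T ^^ k) h)}"

definition orbit_span :: "('a::complex_inner \<Rightarrow> 'a) \<Rightarrow> 'a set \<Rightarrow> nat \<Rightarrow> 'a set"
  where "orbit_span S K n = closure (complex_vector.span {(S ^^ k) h |k h. h \<in> K \<and> k \<ge> n})"

definition compression :: "'a::complex_inner set \<Rightarrow> ('a \<Rightarrow> 'a) \<Rightarrow> 'a \<Rightarrow> 'a"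
  where "compression K T h = orth_proj K (T h)"

definition nilpotent_on :: "'a::complex_inner set \<Rightarrow> ('a \<Rightarrow> 'a) \<Rightarrow> bool"
  where "nilpotent_on K N \<longleftrightarrow> (\<exists>m. \<forall>h\<in>K. (N ^^ m) h = 0)"

definition quasi_affinity ::
    "'a::complex_inner set \<Rightarrow> 'b::complex_inner set \<Rightarrow> ('a \<Rightarrow> 'b) \<Rightarrow> bool"
  where "quasi_affinity K L X \<longleftrightarrow>
    bounded_operator K L X \<and> inj_on X K \<and> L \<subseteq> closure (X ` K)"

definition quasi_similar ::
    "'a::complex_inner set \<Rightarrow> ('a \<Rightarrow> 'a) \<Rightarrow> 'b::complex_inner set \<Rightarrow> ('b \<Rightarrow> 'b) \<Rightarrow> bool"
  where "quasi_similar K A L B \<longleftrightarrow>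
    (\<exists>X Y. quasi_affinity K L X \<and> quasi_affinity L K Y \<and>
       (\<forall>x\<in>K. X (A x) = B (X x)) \<and> (\<forall>y\<in>L. Y (B y) = A (Y y)))"

text \<open>
  The set \<open>isometric_part T\<close> is the maximal invariant subspace on which the contraction \<open>T\<close> is
  isometric.
\<close>

lemma contraction_norm_eq_add:
  assumes T: "contraction T" and x: "norm (T x) = norm x" and y: "norm (T y) = norm y"
  shows "norm (T (x + y)) = norm (x + y)"
proof -
  have add: "T (a + b) = T a + T b" and le: "norm (T a) \<le> norm a" for a b
    using T by (auto simp: contraction_def bounded_operator_def)
  have diff: "T (x - y) = T x - T y"
    using add[of "x - y" y] by simp
  have par: "(norm (a + b))\<^sup>2 + (norm (a - b))\<^sup>2 = 2 * (norm a)\<^sup>2 + 2 * (norm b)\<^sup>2"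
    for a b :: 'a
    by (simp add: power2_norm_eq_inner inner_add inner_diff inner_commute)
  have "(norm (T (x + y)))\<^sup>2 + (norm (T (x - y)))\<^sup>2 = (norm (x + y))\<^sup>2 + (norm (x - y))\<^sup>2"
    unfolding par add diff x y ..
  moreover have "(norm (T (x - y)))\<^sup>2 \<le> (norm (x - y))\<^sup>2"
    using le by (simp add: power_mono)
  ultimately have "(norm (x + y))\<^sup>2 \<le> (norm (T (x + y)))\<^sup>2"
    by linarith
  then have "norm (x + y) \<le> norm (T (x + y))"
    by (rule power2_le_imp_le) simp
  with le[of "x + y"] show ?thesis by simp
qed

lemma isometric_part_maximal:
  assumes T: "contraction T"
  shows "closed_csubspace (isometric_part T)"
    and "T ` isometric_part T \<subseteq> isometric_part T"
    and "\<forall>h\<in>isometric_part T. norm (T h) = norm h"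
    and "closed_csubspace M \<Longrightarrow> T ` M \<subseteq> M \<Longrightarrow> \<forall>h\<in>M. norm (T h) = norm h \<Longrightarrow>
      M \<subseteq> isometric_part T"
proof -
  have add: "T (a + b) = T a + T b" and scale: "T (c *\<^sub>C a) = c *\<^sub>C T a"
    and le: "norm (T a) \<le> norm a" for a b c
    using T by (auto simp: contraction_def bounded_operator_def)
  have T0: "T 0 = 0" using add[of 0 0] by simp
  have nscale: "norm (c *\<^sub>C a) = cmod c * norm a" for c and a :: 'a
  proof -
    have "(c *\<^sub>C a) \<bullet> (c *\<^sub>C a) = Re (c * cnj (c * cinner a a))"
      by (metis Re_cinner cinner_commute cinner_scaleC_left)
    also have "\<dots> = Re ((c * cnj c) * cnj (cinner a a))"
      by (simp add: algebra_simps)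
    also have "\<dots> = (cmod c)\<^sup>2 * (a \<bullet> a)"
      by (simp add: complex_norm_square[symmetric] Re_cinner flip: of_real_power)
    finally show ?thesis
      by (simp add: norm_eq_sqrt_inner real_sqrt_mult)
  qed
  have padd: "(T ^^ k) (a + b) = (T ^^ k) a + (T ^^ k) b" for k a b
    by (induction k) (simp_all add: add)
  have pscale: "(T ^^ k) (c *\<^sub>C a) = c *\<^sub>C (T ^^ k) a" for k c a
    by (induction k) (simp_all add: scale)
  have p0: "(T ^^ k) 0 = 0" for k by (induction k) (simp_all add: T0)
  have lin: "bounded_linear T"
  proof
    show "T (r *\<^sub>R a) = r *\<^sub>R T a" for r a
      using scale[of "complex_of_real r" a] by (simp add: scaleC_of_real)
    show "\<exists>K. \<forall>x. norm (T x) \<le> norm x * K"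
      using le by (intro exI[of _ 1]) simp
  qed (rule add)
  have "bounded_linear (T ^^ k)" for k
    by (induction k) (auto simp: o_def id_def intro: bounded_linear_ident bounded_linear_compose[OF lin])
  then have cont: "continuous_on UNIV (T ^^ k)" for k
    by (rule linear_continuous_on)
  have "closed (isometric_part T)"
    unfolding isometric_part_def Collect_all_eq
    by (intro closed_INT ballI closed_Collect_eq continuous_on_norm cont)
  moreover have "complex_vector.subspace (isometric_part T)"
    unfolding complex_vector.subspace_def isometric_part_def
    using contraction_norm_eq_add[OF T]
    by (auto simp: padd pscale p0 T0 add scale nscale)
  ultimately show "closed_csubspace (isometric_part T)"
    by (simp add: closed_csubspace_def)
  show "T ` isometric_part T \<subseteq> isometric_part T"
  proof (clarsimp simp: isometric_part_def)
    fix h k assume "\<forall>k. norm (T ((T ^^ k) h)) = norm ((T ^^ k) h)"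
    then have "norm (T ((T ^^ Suc k) h)) = norm ((T ^^ Suc k) h)" by blast
    then show "norm (T ((T ^^ k) (T h))) = norm ((T ^^ k) (T h))"
      by (simp add: funpow_swap1)
  qed
  show "\<forall>h\<in>isometric_part T. norm (T h) = norm h"
    by (auto simp: isometric_part_def dest: spec[of _ 0])
  assume M: "closed_csubspace M" "T ` M \<subseteq> M" "\<forall>h\<in>M. norm (T h) = norm h"
  have "(T ^^ k) h \<in> M" if "h \<in> M" for h k
    using M(2) that by (induction k) auto
  with M(3) show "M \<subseteq> isometric_part T"
    by (auto simp: isometric_part_def)
qed

end

theory Submission
  imports Defs
begin

text \<open>
  Write \<open>P\<close> and \<open>Q\<close> for the isometric parts of \<open>T\<close> and \<open>T*\<close>, and \<open>B\<close> for the orthogonal complement of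
  \<open>Q\<close>. Both \<open>P\<close> and \<open>B\<close> are invariant under \<open>T\<close>. The Taylor coefficients of the characteristic function are
  \<open>-T\<close> and the operators \<open>D\<^sub>T\<^sub>* T*\<^sup>k D\<^sub>T\<close>, so that it is a polynomial of degree \<open>n\<close> only if
  \<open>D\<^sub>T\<^sub>* T*\<^sup>k D\<^sub>T\<close> and its adjoint \<open>D\<^sub>T T\<^sup>k D\<^sub>T\<^sub>*\<close> vanish for \<open>k \<ge> n\<close>
  (\<open>defect_funpow_defect_star_eq_0\<close>). Because a vector belongs to the isometric part exactly when its orbit
  is killed by the defect operator, these relations say that the orbit spans of the two canonical
  decompositions lie in \<open>P\<close> and \<open>Q\<close>, and that \<open>T\<^sup>n\<close> maps \<open>B\<close> into \<open>P\<close> (\<open>funpow_in_isometric_part\<close>).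

  It follows that the two central spaces are \<open>B \<ominus> (P \<inter> B)\<close> and \<open>P\<^sup>\<bottom> \<ominus> (Q \<inter> P\<^sup>\<bottom>)\<close> (\<open>central_space_eq\<close>).
  The compressions of \<open>T\<close> to them are the operators that \<open>T\<close> induces on the quotients \<open>B / (P \<inter> B)\<close> and
  \<open>closure (P + B) / P\<close>. They are nilpotent, and the inclusion of \<open>B\<close> induces an injective
  intertwining map with dense range from the first to the second (\<open>semi_invariant_compressions\<close>).

  It remains to find a map in the opposite direction. Between nilpotent operators on separable
  spaces, a quasi-affinity in one direction always yields one in the other (\<open>nilpotent_quasi_affinity_reverse\<close>). As long as the top power has finite rank, Jordan blocks of
  maximal size can be split off compatibly on both sides (\<open>cyclic_splitting\<close>). Once the top power has infinite
  rank, Baire's theorem shows that a generic intertwiner in the closure of the finite rank intertwiners is a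
  quasi-affinity (\<open>quasi_affinity_infinite_multiplicity\<close>); the infinite multiplicity of the largest blocks
  absorbs all smaller ones.
\<close>

section \<open>Complex inner product spaces and bounded operators\<close>

instance complex_hilbert \<subseteq> banach ..

abbreviation bounded_clinear :: "('a::complex_inner \<Rightarrow> 'b::complex_inner) \<Rightarrow> bool"
  where "bounded_clinear f \<equiv> bounded_operator UNIV UNIV f"

lemma cinner_zero_left [simp]: "cinner 0 y = 0"
  using cinner_add_left[of 0 0 y] by simp

lemma cinner_zero_right [simp]: "cinner x 0 = 0"
  by (subst cinner_commute) simp

lemma cinner_minus_left: "cinner (- x) y = - cinner x y"
  using cinner_add_left[of x "- x" y] by (simp add: eq_neg_iff_add_eq_0 add.commute)

lemma cinner_diff_left: "cinner (x - y) z = cinner x z - cinner y z"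
  using cinner_add_left[of x "- y" z] by (simp add: cinner_minus_left)

lemma cinner_add_right: "cinner x (y + z) = cinner x y + cinner x z"
  by (subst (1 2 3) cinner_commute) (simp add: cinner_add_left)

lemma cinner_diff_right: "cinner x (y - z) = cinner x y - cinner x z"
  by (subst (1 2 3) cinner_commute) (simp add: cinner_diff_left)

lemma cinner_scaleC_right: "cinner x (c *\<^sub>C y) = cnj c * cinner x y"
  by (subst (1 2) cinner_commute) (simp add: cinner_scaleC_left)

lemma cinner_sum_left: "cinner (sum f S) y = (\<Sum>i\<in>S. cinner (f i) y)"
  by (induction S rule: infinite_finite_induct) (auto simp: cinner_add_left)

lemmas cinner_simps =
  cinner_add_left cinner_add_right cinner_diff_left cinner_diff_right
  cinner_scaleC_left cinner_scaleC_right

lemma cinner_self: "cinner x x = complex_of_real ((norm x)\<^sup>2)"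
proof (rule complex_eqI)
  show "Re (cinner x x) = Re (complex_of_real ((norm x)\<^sup>2))"
    by (simp add: Re_cinner power2_norm_eq_inner)
  have "cinner x x = cnj (cinner x x)" by (rule cinner_commute)
  then have "Im (cinner x x) = Im (cnj (cinner x x))" by (rule arg_cong)
  then show "Im (cinner x x) = Im (complex_of_real ((norm x)\<^sup>2))" by simp
qed

lemma cinner_self_eq_0_iff [simp]: "cinner x x = 0 \<longleftrightarrow> x = 0"
  by (simp add: cinner_self)

lemma cinner_eq_0_commute: "cinner x y = 0 \<longleftrightarrow> cinner y x = 0"
  by (metis cinner_commute complex_cnj_zero_iff)

lemma norm_scaleC [simp]: "norm (c *\<^sub>C x) = cmod c * norm x"
proof -
  have "complex_of_real ((norm (c *\<^sub>C x))\<^sup>2) = of_real ((cmod c * norm x)\<^sup>2)"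
    unfolding cinner_self[symmetric] cinner_scaleC_left cinner_scaleC_right
     using complex_norm_square[of c] by (simp add: cinner_self power_mult_distrib mult.commute)
  then show ?thesis
    by (metis norm_ge_zero of_real_eq_iff power2_eq_imp_eq zero_le_mult_iff)
qed

lemma cinner_Cauchy_Schwarz: "cmod (cinner x y) \<le> norm x * norm y"
proof -
  \<comment> \<open>Rotating x by c makes the complex inner product real and nonnegative, so that the real
    Cauchy-Schwarz inequality applies.\<close>
  define c where "c = cnj (sgn (cinner x y))"
  have "cmod (cinner x y) = Re (c * cinner x y)"
    by (cases "cinner x y = 0")
       (simp_all add: c_def sgn_eq complex_norm_square[symmetric] power2_eq_square field_simps)
  also have "\<dots> = (c *\<^sub>C x) \<bullet> y"
    by (simp add: Re_cinner flip: cinner_scaleC_left)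
  also have "\<dots> \<le> norm (c *\<^sub>C x) * norm y"
    by (rule norm_cauchy_schwarz)
  also have "\<dots> \<le> norm x * norm y"
    by (intro mult_right_mono) (auto simp: c_def norm_sgn)
  finally show ?thesis .
qed

lemma bounded_linear_cinner_left: "bounded_linear (\<lambda>x. cinner x y)"
proof (rule bounded_linear_intro[where K = "norm y"])
  show "cinner (r *\<^sub>R x) y = r *\<^sub>R cinner x y" for r x
    using cinner_scaleC_left[of "complex_of_real r" x y]
    by (simp add: scaleC_of_real[of r x] scaleR_conv_of_real)
qed (simp_all add: cinner_add_left cinner_Cauchy_Schwarz)

lemma bounded_linear_cinner_right: "bounded_linear (\<lambda>y. cinner x y)"
proof (rule bounded_linear_intro[where K = "norm x"])
  show "cinner x (r *\<^sub>R y) = r *\<^sub>R cinner x y" for r y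
    using cinner_scaleC_right[of x "complex_of_real r" y]
    by (simp add: scaleC_of_real[of r y] scaleR_conv_of_real)
  show "norm (cinner x y) \<le> norm y * norm x" for y
    using cinner_Cauchy_Schwarz[of x y] by (simp add: mult.commute)
qed (simp add: cinner_add_right)

lemmas tendsto_cinner_left = bounded_linear.tendsto[OF bounded_linear_cinner_left]
lemmas tendsto_cinner_right = bounded_linear.tendsto[OF bounded_linear_cinner_right]

lemma bounded_linear_scaleC_left:
  fixes x :: "'a::complex_inner"
  shows "bounded_linear (\<lambda>c. c *\<^sub>C x)"
proof (rule bounded_linear_intro[where K = "norm x"])
  show "(r *\<^sub>R c) *\<^sub>C x = r *\<^sub>R (c *\<^sub>C x)" for r c
    by (metis scaleC_of_real scaleC_scaleC scaleR_conv_of_real)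
qed (simp_all add: scaleC_add_left)

lemma bounded_clinearI:
  assumes "\<And>x y. f (x + y) = f x + f y" "\<And>c x. f (c *\<^sub>C x) = c *\<^sub>C f x"
    and "\<And>x. norm (f x) \<le> C * norm x"
  shows "bounded_clinear f"
  using assms by (auto simp: bounded_operator_def)

lemma bounded_clinear_add: "bounded_clinear f \<Longrightarrow> f (x + y) = f x + f y"
  by (simp add: bounded_operator_def)

lemma bounded_clinear_scaleC: "bounded_clinear f \<Longrightarrow> f (c *\<^sub>C x) = c *\<^sub>C f x"
  by (simp add: bounded_operator_def)

lemma bounded_clinear_bounded_linear:
  assumes "bounded_clinear f"
  shows "bounded_linear f"
proof -
  obtain C where "\<And>x. norm (f x) \<le> C * norm x"
    using assms by (auto simp: bounded_operator_def)
  then show ?thesis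
    by (intro bounded_linear_intro[where K = C])
       (use bounded_clinear_scaleC[OF assms, of "complex_of_real _"] in
         \<open>simp_all add: bounded_clinear_add[OF assms] scaleC_of_real mult.commute\<close>)
qed

lemma bounded_clinear_iff:
  "bounded_clinear f \<longleftrightarrow> bounded_linear f \<and> (\<forall>c x. f (c *\<^sub>C x) = c *\<^sub>C f x)"
proof (intro iffI conjI allI)
  assume f: "bounded_linear f \<and> (\<forall>c x. f (c *\<^sub>C x) = c *\<^sub>C f x)"
  then interpret bounded_linear f by blast
  obtain C where "\<And>x. norm (f x) \<le> norm x * C" using bounded by blast
  then show "bounded_clinear f"
    using f add by (intro bounded_clinearI[where C = C]) (auto simp: mult.commute)
qed (auto intro: bounded_clinear_bounded_linear bounded_clinear_scaleC)

lemma bounded_clinear_cinner_left: "bounded_clinear (\<lambda>x. cinner x y)"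
  by (simp add: bounded_clinear_iff bounded_linear_cinner_left cinner_scaleC_left scaleC_complex_def)

lemma bounded_clinear_zero: "bounded_clinear f \<Longrightarrow> f 0 = 0"
  by (intro linear_simps bounded_clinear_bounded_linear)

lemma bounded_clinear_diff: "bounded_clinear f \<Longrightarrow> f (x - y) = f x - f y"
  by (intro linear_simps bounded_clinear_bounded_linear)

lemma bounded_clinear_sum: "bounded_clinear f \<Longrightarrow> f (sum g S) = (\<Sum>i\<in>S. f (g i))"
  by (intro linear_sum bounded_linear.linear bounded_clinear_bounded_linear)

lemma bounded_clinear_tendsto:
  "bounded_clinear f \<Longrightarrow> (g \<longlongrightarrow> l) F \<Longrightarrow> ((\<lambda>x. f (g x)) \<longlongrightarrow> f l) F"
  by (rule bounded_linear.tendsto[OF bounded_clinear_bounded_linear])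

lemma bounded_clinear_continuous: "bounded_clinear f \<Longrightarrow> continuous_on S f"
  by (intro linear_continuous_on bounded_clinear_bounded_linear)

lemma bounded_clinear_ident: "bounded_clinear (\<lambda>x. x)"
  by (simp add: bounded_clinear_iff)

lemma bounded_clinear_compose:
  "bounded_clinear f \<Longrightarrow> bounded_clinear g \<Longrightarrow> bounded_clinear (\<lambda>x. f (g x))"
  by (simp add: bounded_clinear_iff bounded_linear_compose)

lemma bounded_clinear_plus:
  "bounded_clinear f \<Longrightarrow> bounded_clinear g \<Longrightarrow> bounded_clinear (\<lambda>x. f x + g x)"
  by (simp add: bounded_clinear_iff bounded_linear_add scaleC_add_right)

lemma bounded_clinear_sub:
  "bounded_clinear f \<Longrightarrow> bounded_clinear g \<Longrightarrow> bounded_clinear (\<lambda>x. f x - g x)"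
  by (simp add: bounded_clinear_iff bounded_linear_sub complex_vector.scale_right_diff_distrib)

lemma bounded_clinear_funpow:
  fixes f :: "'a::complex_inner \<Rightarrow> 'a"
  shows "bounded_clinear f \<Longrightarrow> bounded_clinear (f ^^ k)"
proof (induction k)
  case 0
  show ?case by (simp add: id_def bounded_clinear_ident)
next
  case (Suc k)
  then show ?case using bounded_clinear_compose[of f "f ^^ k"] by (simp add: o_def)
qed

lemma bounded_clinear_scaled:
  fixes f :: "'a::complex_inner \<Rightarrow> 'b::complex_inner"
  assumes "bounded_clinear f"
  shows "bounded_clinear (\<lambda>x. c *\<^sub>C f x)"
proof -
  have "bounded_clinear (\<lambda>y::'b. c *\<^sub>C y)"
    by (rule bounded_clinearI[where C = "cmod c"])
       (simp_all add: scaleC_add_right scaleC_scaleC mult.commute)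
  then show ?thesis using assms by (rule bounded_clinear_compose)
qed

lemma bounded_clinear_sum_fun:
  "(\<And>i. i \<in> S \<Longrightarrow> bounded_clinear (f i)) \<Longrightarrow> bounded_clinear (\<lambda>x. \<Sum>i\<in>S. f i x)"
proof (induction S rule: infinite_finite_induct)
  case (insert a S)
  then show ?case by (simp add: bounded_clinear_plus)
qed (simp_all add: bounded_clinear_iff)

lemma bounded_clinear_rank_one: "bounded_clinear (\<lambda>x. cinner x u *\<^sub>C v)"
  using bounded_linear_compose[OF bounded_linear_scaleC_left bounded_linear_cinner_left]
  by (auto simp: bounded_clinear_iff cinner_scaleC_left scaleC_scaleC)

lemma closed_csubspace_0: "closed_csubspace M \<Longrightarrow> 0 \<in> M"
  by (simp add: closed_csubspace_def complex_vector.subspace_0)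

lemma closed_csubspace_add: "closed_csubspace M \<Longrightarrow> x \<in> M \<Longrightarrow> y \<in> M \<Longrightarrow> x + y \<in> M"
  by (simp add: closed_csubspace_def complex_vector.subspace_add)

lemma closed_csubspace_diff: "closed_csubspace M \<Longrightarrow> x \<in> M \<Longrightarrow> y \<in> M \<Longrightarrow> x - y \<in> M"
  by (simp add: closed_csubspace_def complex_vector.subspace_diff)

lemma closed_csubspace_scaleC: "closed_csubspace M \<Longrightarrow> x \<in> M \<Longrightarrow> c *\<^sub>C x \<in> M"
  by (simp add: closed_csubspace_def complex_vector.subspace_scale)

lemma closed_csubspace_UNIV: "closed_csubspace UNIV"
  by (simp add: closed_csubspace_def)

lemma closed_csubspace_Int: "closed_csubspace M \<Longrightarrow> closed_csubspace K \<Longrightarrow> closed_csubspace (M \<inter> K)"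
  by (auto simp: closed_csubspace_def complex_vector.subspace_inter closed_Int)

lemma closed_csubspace_vimage:
  assumes "bounded_clinear f" "closed_csubspace M"
  shows "closed_csubspace {x. f x \<in> M}"
proof -
  have "closed (f -` M)"
    by (rule continuous_closed_vimage)
       (use assms bounded_clinear_continuous[OF assms(1), of UNIV] in
         \<open>auto simp: closed_csubspace_def continuous_on_eq_continuous_at\<close>)
  then show ?thesis
    using assms
    by (auto simp: closed_csubspace_def complex_vector.subspace_def vimage_def
        bounded_clinear_add bounded_clinear_scaleC bounded_clinear_zero)
qed

lemma closed_csubspace_closure:
  assumes "complex_vector.subspace M"
  shows "closed_csubspace (closure M)"
  unfolding closed_csubspace_def complex_vector.subspace_def
proof (intro conjI ballI allI)
  show "0 \<in> closure M"
    using assms complex_vector.subspace_0 closure_subset by blast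
  show "x + y \<in> closure M" if xy: "x \<in> closure M" "y \<in> closure M" for x y
  proof -
    obtain a b where "\<And>n. a n \<in> M" "a \<longlonglongrightarrow> x" "\<And>n. b n \<in> M" "b \<longlonglongrightarrow> y"
      using xy unfolding closure_sequential by blast
    then show ?thesis
      unfolding closure_sequential
      by (intro exI[of _ "\<lambda>n. a n + b n"])
         (auto intro: tendsto_add complex_vector.subspace_add[OF assms])
  qed
  show "c *\<^sub>C x \<in> closure M" if x: "x \<in> closure M" for x c
  proof -
    obtain a where "\<And>n. a n \<in> M" "a \<longlonglongrightarrow> x"
      using x unfolding closure_sequential by blast
    then show ?thesis
      unfolding closure_sequential
      by (intro exI[of _ "\<lambda>n. c *\<^sub>C a n"])
         (auto intro: bounded_clinear_tendsto[OF bounded_clinear_scaled[OF bounded_clinear_ident]]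
            complex_vector.subspace_scale[OF assms])
  qed
qed simp

lemma closed_csubspace_orth_diff:
  assumes "closed_csubspace K"
  shows "closed_csubspace (K \<ominus> L)"
proof -
  have "K \<ominus> L = K \<inter> (\<Inter>y\<in>L. {x. cinner x y = 0})"
    by (auto simp: orth_diff_def)
  moreover have "closed {x. cinner x y = 0}" for y :: 'a
    by (intro closed_Collect_eq linear_continuous_on bounded_linear_cinner_left) simp
  ultimately have "closed (K \<ominus> L)"
    using assms by (auto simp: closed_csubspace_def intro!: closed_Int closed_INT)
  then show ?thesis
    using assms
    by (auto simp: closed_csubspace_def complex_vector.subspace_def orth_diff_def cinner_simps)
qed

lemma closure_orthogonal:
  assumes "x \<in> closure S" "\<And>s. s \<in> S \<Longrightarrow> cinner s y = 0"
  shows "cinner x y = 0"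
proof -
  obtain a where "\<And>n. a n \<in> S" "a \<longlonglongrightarrow> x"
    using assms(1) unfolding closure_sequential by blast
  then show ?thesis
    using tendsto_cinner_left[of a x sequentially y] assms(2) by (simp add: LIMSEQ_const_iff)
qed

lemma closure_limitI:
  fixes y :: "'a::metric_space"
  shows "(\<And>n. f n \<in> S) \<Longrightarrow> f \<longlonglongrightarrow> y \<Longrightarrow> y \<in> closure S"
  unfolding closure_sequential by blast

section \<open>Orthogonal projections and adjoints\<close>

lemma parallelogram_law:
  fixes a b :: "'a::real_inner"
  shows "(norm (a + b))\<^sup>2 + (norm (a - b))\<^sup>2 = 2 * (norm a)\<^sup>2 + 2 * (norm b)\<^sup>2"
  by (simp add: power2_norm_eq_inner inner_add inner_diff inner_commute)

lemma norm_diff_projection: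
  assumes "k \<noteq> 0"
  shows "(norm (x - (cinner x k / of_real ((norm k)\<^sup>2)) *\<^sub>C k))\<^sup>2
    = (norm x)\<^sup>2 - (cmod (cinner x k))\<^sup>2 / (norm k)\<^sup>2"
proof -
  define c where "c = cinner x k / of_real ((norm k)\<^sup>2)"
  have ck: "c * of_real ((norm k)\<^sup>2) = cinner x k"
    using assms by (simp add: c_def)
  have kx: "cinner k x = cnj (cinner x k)" by (rule cinner_commute)
  have "complex_of_real ((norm (x - c *\<^sub>C k))\<^sup>2) = cinner (x - c *\<^sub>C k) (x - c *\<^sub>C k)"
    by (simp only: cinner_self)
  also have "\<dots> = cinner x x - cnj c * cinner x k - c * cnj (cinner x k) + c * cnj c * of_real ((norm k)\<^sup>2)"
    by (simp only: cinner_simps cinner_self[of k] kx) (simp add: algebra_simps)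
  also have "c * cnj c * of_real ((norm k)\<^sup>2) = cnj c * cinner x k"
    by (simp only: ck[symmetric] mult_ac)
  also have "cinner x x - cnj c * cinner x k - c * cnj (cinner x k) + cnj c * cinner x k
    = cinner x x - c * cnj (cinner x k)" by simp
  also have "c * cnj (cinner x k) = of_real ((cmod (cinner x k))\<^sup>2 / (norm k)\<^sup>2)"
    unfolding c_def using complex_norm_square[of "cinner x k"] by simp
  also have "cinner x x - of_real ((cmod (cinner x k))\<^sup>2 / (norm k)\<^sup>2)
    = of_real ((norm x)\<^sup>2 - (cmod (cinner x k))\<^sup>2 / (norm k)\<^sup>2)"
    by (simp add: cinner_self)
  finally show ?thesis
    unfolding c_def of_real_eq_iff .
qed

text \<open>
  A sequence in the subspace whose distances to the point approach the infimum is Cauchy by the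
  parallelogram law, and its limit realises the distance. If the error had a nonzero inner product with
  some vector of the subspace, removing the component along that vector would decrease the distance.
\<close>

lemma projection_exists:
  fixes K :: "'a::complex_hilbert set"
  assumes K: "closed_csubspace K"
  shows "\<exists>y\<in>K. \<forall>k\<in>K. cinner (x - y) k = 0"
proof -
  define S where "S = (\<lambda>y. (norm (x - y))\<^sup>2) ` K"
  define d where "d = Inf S"
  have ne: "S \<noteq> {}" and bdd: "bdd_below S"
    using closed_csubspace_0[OF K] by (auto simp: S_def intro: bdd_belowI2[where m = 0])
  have lower: "d \<le> (norm (x - y))\<^sup>2" if "y \<in> K" for y
    unfolding d_def using that bdd by (intro cInf_lower) (auto simp: S_def)
  have "\<exists>y\<in>K. (norm (x - y))\<^sup>2 < d + inverse (Suc n)" for n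
  proof -
    have "Inf S < d + inverse (Suc n)" by (simp add: d_def)
    then show ?thesis
      using cInf_lessD[OF ne] by (auto simp: S_def)
  qed
  then obtain y where yK: "\<And>n. y n \<in> K"
    and y: "\<And>n. (norm (x - y n))\<^sup>2 < d + inverse (Suc n)" by metis
  have close: "(norm (y m - y n))\<^sup>2 \<le> 4 * inverse (Suc N)" if "N \<le> m" "N \<le> n" for m n N
  proof -
    have "(1/2) *\<^sub>R (y m + y n) \<in> K"
      using closed_csubspace_scaleC[OF K closed_csubspace_add[OF K yK[of m] yK[of n]], of "of_real (1/2)"]
      by (simp only: scaleC_of_real)
    then have "4 * d \<le> 4 * (norm (x - (1/2) *\<^sub>R (y m + y n)))\<^sup>2"
      using lower by simp
    also have "\<dots> = (norm ((x - y m) + (x - y n)))\<^sup>2"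
    proof -
      have "(x - y m) + (x - y n) = 2 *\<^sub>R (x - (1/2) *\<^sub>R (y m + y n))"
        by (simp add: algebra_simps scaleR_2)
      then show ?thesis by (simp only: norm_scaleR) (simp add: power_mult_distrib)
    qed
    finally have "4 * d + (norm (y m - y n))\<^sup>2 \<le> 2 * (norm (x - y m))\<^sup>2 + 2 * (norm (x - y n))\<^sup>2"
      using parallelogram_law[of "x - y m" "x - y n"]
      by (simp add: norm_minus_commute)
    moreover have "inverse (real (Suc m)) \<le> inverse (Suc N)" "inverse (real (Suc n)) \<le> inverse (Suc N)"
      using that by (auto intro!: le_imp_inverse_le)
    ultimately show ?thesis using y[of m] y[of n] by linarith
  qed
  have "Cauchy y"
  proof (rule metric_CauchyI)
    fix e :: real assume "0 < e"
    then have "0 < e\<^sup>2 / 4" by simp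
    then obtain N where "inverse (real (Suc N)) < e\<^sup>2 / 4"
      using reals_Archimedean by blast
    then have "4 * inverse (real (Suc N)) < e\<^sup>2" by linarith
    then have "\<forall>m\<ge>N. \<forall>n\<ge>N. (norm (y m - y n))\<^sup>2 < e\<^sup>2"
      using close[of N] by (blast intro: le_less_trans)
    then show "\<exists>N. \<forall>m\<ge>N. \<forall>n\<ge>N. dist (y m) (y n) < e"
      using \<open>0 < e\<close> by (metis dist_norm less_eq_real_def power2_less_imp_less)
  qed
  then obtain l where l: "y \<longlonglongrightarrow> l"
    by (auto simp: Cauchy_convergent_iff convergent_def)
  have "l \<in> K"
    using K l yK by (auto simp: closed_csubspace_def closed_sequential_limits)
  have "(norm (x - l))\<^sup>2 \<le> d"
  proof (rule LIMSEQ_le)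
    show "(\<lambda>n. (norm (x - y n))\<^sup>2) \<longlonglongrightarrow> (norm (x - l))\<^sup>2"
      by (intro tendsto_intros l)
    show "(\<lambda>n. d + inverse (Suc n)) \<longlonglongrightarrow> d"
      using tendsto_add[OF tendsto_const LIMSEQ_inverse_real_of_nat, of d] by simp
    show "\<exists>N. \<forall>n\<ge>N. (norm (x - y n))\<^sup>2 \<le> d + inverse (Suc n)"
      using y less_imp_le by blast
  qed
  have "cinner (x - l) k = 0" if k: "k \<in> K" for k
  proof (rule ccontr)
    assume nz: "cinner (x - l) k \<noteq> 0"
    then have "k \<noteq> 0" by auto
    define c where "c = cinner (x - l) k / of_real ((norm k)\<^sup>2)"
    have "l + c *\<^sub>C k \<in> K"
      using K k \<open>l \<in> K\<close> by (simp add: closed_csubspace_add closed_csubspace_scaleC)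
    then have "d \<le> (norm (x - l - c *\<^sub>C k))\<^sup>2"
      using lower[of "l + c *\<^sub>C k"] by (simp add: diff_diff_eq)
    also have "\<dots> = (norm (x - l))\<^sup>2 - (cmod (cinner (x - l) k))\<^sup>2 / (norm k)\<^sup>2"
      unfolding c_def by (rule norm_diff_projection) fact
    also have "\<dots> < d"
      using \<open>(norm (x - l))\<^sup>2 \<le> d\<close> nz \<open>k \<noteq> 0\<close> by (smt (verit) divide_pos_pos zero_less_norm_iff zero_less_power)
    finally show False by simp
  qed
  then show ?thesis using \<open>l \<in> K\<close> by blast
qed

lemma orth_proj_eqI:
  assumes K: "closed_csubspace K" and "y \<in> K" "\<And>k. k \<in> K \<Longrightarrow> cinner (x - y) k = 0"
  shows "orth_proj K x = y"
  unfolding orth_proj_def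
proof (rule the_equality)
  fix z assume z: "z \<in> K \<and> x - z \<in> UNIV \<ominus> K"
  then have "z - y \<in> K" using assms by (simp add: closed_csubspace_diff)
  with z assms have "cinner (x - y) (z - y) = 0" "cinner (x - z) (z - y) = 0"
    by (auto simp: orth_diff_def)
  then have "cinner ((x - y) - (x - z)) (z - y) = 0"
    by (simp only: cinner_diff_left) simp
  then show "z = y" by simp
qed (use assms in \<open>auto simp: orth_diff_def\<close>)

context
  fixes K :: "'a::complex_hilbert set"
  assumes K: "closed_csubspace K"
begin

lemma orth_proj_in: "orth_proj K x \<in> K"
  and cinner_diff_orth_proj: "k \<in> K \<Longrightarrow> cinner (x - orth_proj K x) k = 0"
  using projection_exists[OF K, of x] orth_proj_eqI[OF K, of _ x] by metis+

lemma cinner_orth_proj: "k \<in> K \<Longrightarrow> cinner (orth_proj K x) k = cinner x k"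
  using cinner_diff_orth_proj[of k x] by (simp add: cinner_diff_left)

lemma orth_proj_id: "x \<in> K \<Longrightarrow> orth_proj K x = x"
  by (rule orth_proj_eqI[OF K]) auto

lemma orth_proj_eq_0: "(\<And>k. k \<in> K \<Longrightarrow> cinner x k = 0) \<Longrightarrow> orth_proj K x = 0"
  by (rule orth_proj_eqI[OF K]) (auto simp: closed_csubspace_0[OF K])

lemma norm_orth_proj_le: "norm (orth_proj K x) \<le> norm x"
proof -
  have "(norm (orth_proj K x))\<^sup>2 = cmod (cinner (orth_proj K x) (orth_proj K x))"
    unfolding cinner_self norm_of_real by simp
  also have "\<dots> = cmod (cinner x (orth_proj K x))"
    by (simp only: cinner_orth_proj[OF orth_proj_in])
  also have "\<dots> \<le> norm x * norm (orth_proj K x)"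
    by (rule cinner_Cauchy_Schwarz)
  finally show ?thesis
    by (cases "orth_proj K x = 0") (simp_all add: power2_eq_square)
qed

lemma bounded_clinear_orth_proj: "bounded_clinear (orth_proj K)"
proof (rule bounded_clinearI[where C = 1])
  show "orth_proj K (x + y) = orth_proj K x + orth_proj K y" for x y
    by (rule orth_proj_eqI[OF K])
       (auto simp: closed_csubspace_add[OF K] orth_proj_in cinner_simps cinner_orth_proj)
  show "orth_proj K (c *\<^sub>C x) = c *\<^sub>C orth_proj K x" for c x
    by (rule orth_proj_eqI[OF K])
       (auto simp: closed_csubspace_scaleC[OF K] orth_proj_in cinner_simps cinner_orth_proj)
qed (simp add: norm_orth_proj_le)

text \<open>
  The error of projecting a point of \<open>K\<close> onto the closure of \<open>S\<close> lies in \<open>K\<close> and is orthogonal to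
  \<open>S\<close>, so it vanishes.
\<close>

lemma dense_if_no_orthogonal:
  assumes S: "complex_vector.subspace S" and "S \<subseteq> K"
    and 0: "\<And>y. y \<in> K \<Longrightarrow> (\<And>s. s \<in> S \<Longrightarrow> cinner y s = 0) \<Longrightarrow> y = 0"
  shows "K \<subseteq> closure S"
proof
  fix x assume x: "x \<in> K"
  obtain y where y: "y \<in> closure S" "\<And>k. k \<in> closure S \<Longrightarrow> cinner (x - y) k = 0"
    using projection_exists[OF closed_csubspace_closure[OF S]] by blast
  have "closure S \<subseteq> K"
    using K \<open>S \<subseteq> K\<close> by (simp add: closed_csubspace_def closure_minimal)
  then have "x - y \<in> K" using x y K by (auto intro: closed_csubspace_diff)
  then have "x - y = 0"
    using y(2) closure_subset by (intro 0) blast+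
  then show "x \<in> closure S" using y by simp
qed

end

text \<open>
  A functional is determined by its kernel, a hyperplane, up to a scalar; a vector orthogonal to the kernel
  represents it after rescaling.
\<close>

lemma Riesz_representation:
  fixes f :: "'a::complex_hilbert \<Rightarrow> complex"
  assumes f: "bounded_clinear f"
  shows "\<exists>u. \<forall>x. f x = cinner x u"
proof (cases "\<forall>x. f x = 0")
  case True
  then show ?thesis by (intro exI[of _ 0]) simp
next
  case False
  then obtain a where a: "f a \<noteq> 0" by blast
  have sub: "closed_csubspace {x. f x \<in> {0}}"
    by (intro closed_csubspace_vimage f) (simp add: closed_csubspace_def)
  obtain y where y: "f y = 0" "\<And>k. f k = 0 \<Longrightarrow> cinner (a - y) k = 0"
    using projection_exists[OF sub, of a] by auto
  define w where "w = a - y"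
  have fw: "f w \<noteq> 0" using a y by (simp add: w_def bounded_clinear_diff[OF f])
  then have w0: "w \<noteq> 0" using bounded_clinear_zero[OF f] by auto
  have "f x = cinner x (cnj (f w / cinner w w) *\<^sub>C w)" for x
  proof -
    have "f (f w *\<^sub>C x - f x *\<^sub>C w) = 0"
      by (simp add: bounded_clinear_diff[OF f] bounded_clinear_scaleC[OF f] scaleC_complex_def)
    then have "cinner w (f w *\<^sub>C x - f x *\<^sub>C w) = 0"
      using y(2) by (simp add: w_def)
    then have "cinner (f w *\<^sub>C x - f x *\<^sub>C w) w = 0"
      by (simp only: cinner_eq_0_commute)
    then have "f w * cinner x w = f x * cinner w w"
      by (simp add: cinner_simps)
    then show ?thesis using w0 by (simp add: cinner_simps field_simps)
  qed
  then show ?thesis by blast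
qed

lemma cinner_ext: "(\<And>x. cinner x y = cinner x z) \<Longrightarrow> y = z"
proof -
  assume "\<And>x. cinner x y = cinner x z"
  then have "cinner (y - z) (y - z) = 0" by (simp only: cinner_diff_right) simp
  then show ?thesis by simp
qed

lemma cinner_cadjoint:
  fixes T :: "'a::complex_hilbert \<Rightarrow> 'a"
  assumes T: "bounded_clinear T"
  shows "cinner (T x) y = cinner x (cadjoint T y)"
proof -
  have "\<exists>u. \<forall>x. cinner (T x) y = cinner x u" for y
  proof (rule Riesz_representation)
    show "bounded_clinear (\<lambda>x. cinner (T x) y)"
      using bounded_linear_compose[OF bounded_linear_cinner_left bounded_clinear_bounded_linear[OF T]]
      by (auto simp: bounded_clinear_iff bounded_clinear_scaleC[OF T] cinner_scaleC_left scaleC_complex_def)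
  qed
  then obtain S where S: "\<And>x y. cinner (T x) y = cinner x (S y)" by metis
  have "cadjoint T = S"
    unfolding cadjoint_def
  proof (rule the_equality)
    fix R assume R: "\<forall>x y. cinner (T x) y = cinner x (R y)"
    have "R y = S y" for y
      by (rule cinner_ext) (metis R S)
    then show "R = S" by blast
  qed (simp add: S)
  then show ?thesis by (simp add: S)
qed

lemma cinner_cadjoint':
  fixes T :: "'a::complex_hilbert \<Rightarrow> 'a"
  assumes "bounded_clinear T"
  shows "cinner (cadjoint T x) y = cinner x (T y)"
  using cinner_cadjoint[OF assms, of y x] cinner_commute[of "T y" x] cinner_commute[of y "cadjoint T x"] by simp

lemma norm_le_by_cinner:
  assumes "\<And>y. cmod (cinner x y) \<le> C * norm y" "0 \<le> C"
  shows "norm x \<le> C"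
proof -
  have "norm x * norm x \<le> C * norm x"
    using assms(1)[of x] unfolding cinner_self norm_of_real by (simp add: power2_eq_square)
  then show ?thesis using assms(2) by (cases "x = 0") auto
qed

lemma bounded_clinear_cadjoint:
  fixes T :: "'a::complex_hilbert \<Rightarrow> 'a"
  assumes T: "bounded_clinear T"
  shows "bounded_clinear (cadjoint T)"
proof -
  obtain C where C: "\<And>x. norm (T x) \<le> norm x * C" "0 \<le> C"
    using bounded_linear.nonneg_bounded[OF bounded_clinear_bounded_linear[OF T]] by blast
  show ?thesis
  proof (rule bounded_clinearI[where C = C])
    show "cadjoint T (x + y) = cadjoint T x + cadjoint T y" for x y
      by (rule cinner_ext) (simp add: cinner_add_right flip: cinner_cadjoint[OF T])
    show "cadjoint T (c *\<^sub>C x) = c *\<^sub>C cadjoint T x" for c x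
      by (rule cinner_ext) (simp add: cinner_scaleC_right flip: cinner_cadjoint[OF T])
    show "norm (cadjoint T x) \<le> C * norm x" for x
    proof (rule norm_le_by_cinner)
      fix y
      have "cmod (cinner (cadjoint T x) y) \<le> norm x * norm (T y)"
        unfolding cinner_cadjoint'[OF T] by (rule cinner_Cauchy_Schwarz)
      also have "\<dots> \<le> norm x * (norm y * C)"
        by (intro mult_left_mono C) simp
      finally show "cmod (cinner (cadjoint T x) y) \<le> C * norm x * norm y"
        by (simp add: mult_ac)
    qed (simp add: C)
  qed
qed

section \<open>Positive square roots and defect operators\<close>

text \<open>
  Over the complex numbers the quadratic form determines the operator: testing with \<open>x + y\<close> and
  \<open>x + \<i>y\<close> separates the two mixed terms.
\<close>

lemma cinner_polarization:
  assumes S: "bounded_clinear S" and 0: "\<And>x. cinner (S x) x = 0"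
  shows "S x = 0"
proof -
  have "cinner (S x) y = 0" for x y
  proof -
    have 1: "cinner (S x) y + cinner (S y) x = 0"
      using 0[of "x + y"] by (simp add: bounded_clinear_add[OF S] cinner_simps 0 add.commute)
    have "- \<i> * cinner (S x) y + \<i> * cinner (S y) x = 0"
      using 0[of "x + \<i> *\<^sub>C y"]
      by (simp add: bounded_clinear_add[OF S] bounded_clinear_scaleC[OF S] cinner_simps 0)
    then have "cinner (S x) y = cinner (S y) x" by (simp add: field_simps)
    with 1 show ?thesis by simp
  qed
  from this[of x "S x"] show ?thesis by simp
qed

lemma positive_operator_selfadjoint:
  fixes B :: "'a::complex_hilbert \<Rightarrow> 'a"
  assumes "positive_operator B"
  shows "cinner (B x) y = cinner x (B y)"
proof -
  have B: "bounded_clinear B" and real: "\<And>x. cinner (B x) x \<in> \<real>\<^sub>\<ge>\<^sub>0"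
    using assms by (auto simp: positive_operator_def)
  have "B x - cadjoint B x = 0" for x
  proof (rule cinner_polarization[of "\<lambda>x. B x - cadjoint B x"])
    show "bounded_clinear (\<lambda>x. B x - cadjoint B x)"
      by (intro bounded_clinear_sub B bounded_clinear_cadjoint)
    fix x
    have "cinner (B x) x = cnj (cinner (B x) x)"
      using real[of x] by (auto simp: complex_nonneg_Reals_iff complex_eq_iff)
    then show "cinner (B x - cadjoint B x) x = 0"
      by (simp add: cinner_diff_left cinner_cadjoint'[OF B] cinner_commute[of x "B x"])
  qed
  then show ?thesis using cinner_cadjoint[OF B, of x y] by simp
qed

text \<open>
  The root of \<open>I - C\<close> is \<open>I - R\<close> where \<open>2R = C + R\<^sup>2\<close>. This fixed point is the limit of the iteration
  \<open>Y\<^sub>0 = 0\<close>, \<open>Y\<^sub>k\<^sub>+\<^sub>1 = (C + Y\<^sub>k\<^sup>2)/2\<close>. Because \<open>C\<close> is a contraction, the iteration is dominated in norm by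
  the same scalar iteration with \<open>C\<close> replaced by \<open>1\<close>, which increases and is bounded by \<open>1\<close>. The iterates
  are polynomials in \<open>C\<close>; hence the root commutes with everything that commutes with \<open>C\<close>, and this is
  what makes it unique.
\<close>

lemma positive_square_root_exists:
  fixes C :: "'a::complex_hilbert \<Rightarrow> 'a"
  assumes C: "bounded_clinear C" and le: "\<And>x. norm (C x) \<le> norm x"
    and sa: "\<And>x y. cinner (C x) y = cinner x (C y)"
  shows "\<exists>B. positive_operator B \<and> B \<circ> B = (\<lambda>x. x - C x) \<and>
    (\<forall>Z. bounded_clinear Z \<longrightarrow> (\<forall>x. Z (C x) = C (Z x)) \<longrightarrow> (\<forall>x. Z (B x) = B (Z x)))"
proof -
  define Y :: "nat \<Rightarrow> 'a \<Rightarrow> 'a"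
    where "Y = rec_nat (\<lambda>_. 0) (\<lambda>_ W x. (1/2) *\<^sub>C (C x + W (W x)))"
  define y :: "nat \<Rightarrow> real" where "y = rec_nat 0 (\<lambda>_ r. (1 + r\<^sup>2) / 2)"
  have Y0: "Y 0 = (\<lambda>_. 0)" and YS: "Y (Suc k) = (\<lambda>x. (1/2) *\<^sub>C (C x + Y k (Y k x)))" for k
    by (simp_all add: Y_def)
  have y0: "y 0 = 0" and yS: "y (Suc k) = (1 + (y k)\<^sup>2) / 2" for k
    by (simp_all add: y_def)
  have lin: "bounded_clinear (Y k)" for k
  proof (induction k)
    case 0 show ?case by (simp add: Y0 bounded_clinear_iff)
  next
    case (Suc k)
    show ?case
      unfolding YS
      by (rule bounded_clinear_scaled[OF bounded_clinear_plus[OF C bounded_clinear_compose[OF Suc Suc]]])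
  qed
  have y_nonneg: "0 \<le> y k" for k by (cases k) (simp_all add: y0 yS)
  have y_le: "y k \<le> 1" for k
    by (induction k) (simp_all add: y0 yS power_le_one y_nonneg)
  have y_mono: "y k \<le> y (Suc k)" for k
  proof -
    have "0 \<le> (1 - y k)\<^sup>2" by simp
    then have "2 * y k \<le> 1 + (y k)\<^sup>2" by (simp add: power2_diff)
    then show ?thesis by (simp add: yS)
  qed
  have bound: "norm (Y k x) \<le> y k * norm x" for k x
  proof (induction k arbitrary: x)
    case (Suc k)
    have "norm (Y k (Y k x)) \<le> y k * (y k * norm x)"
      using Suc[of "Y k x"] mult_left_mono[OF Suc[of x] y_nonneg[of k]] by linarith
    then have "norm (C x + Y k (Y k x)) \<le> norm x + (y k)\<^sup>2 * norm x"
      using le[of x] norm_triangle_le[of "C x" "Y k (Y k x)"] by (simp add: power2_eq_square mult.assoc)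
    moreover have "2 * norm (Y (Suc k) x) = norm (C x + Y k (Y k x))"
      by (simp add: YS norm_divide)
    moreover have "2 * (y (Suc k) * norm x) = norm x + (y k)\<^sup>2 * norm x"
      by (simp add: yS distrib_right)
    ultimately show ?case by linarith
  qed (simp add: Y0 y0)
  \<comment> \<open>The differences of consecutive iterates are dominated by those of the scalar iteration,
    which telescope in the next step.\<close>
  have consecutive: "norm (Y (Suc k) x - Y k x) \<le> (y (Suc k) - y k) * norm x" for k x
  proof (induction k arbitrary: x)
    case 0 then show ?case using le[of x] by (simp add: Y0 YS y0 yS norm_divide)
  next
    case (Suc k)
    let ?d = "y (Suc k) - y k"
    have "Y (Suc (Suc k)) x - Y (Suc k) x = (1/2) *\<^sub>C
        ((C x + Y (Suc k) (Y (Suc k) x)) - (C x + Y k (Y k x)))"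
      by (simp only: YS complex_vector.scale_right_diff_distrib)
    also have "\<dots> = (1/2) *\<^sub>C
        (Y (Suc k) (Y (Suc k) x - Y k x) + (Y (Suc k) (Y k x) - Y k (Y k x)))"
      by (simp add: bounded_clinear_diff[OF lin])
    finally have eq: "2 * norm (Y (Suc (Suc k)) x - Y (Suc k) x) =
        norm (Y (Suc k) (Y (Suc k) x - Y k x) + (Y (Suc k) (Y k x) - Y k (Y k x)))"
      by (simp add: norm_divide)
    have "norm (Y (Suc k) (Y (Suc k) x - Y k x)) \<le> y (Suc k) * (?d * norm x)"
      using bound[of "Suc k" "Y (Suc k) x - Y k x"] mult_left_mono[OF Suc[of x] y_nonneg[of "Suc k"]]
      by linarith
    moreover have "norm (Y (Suc k) (Y k x) - Y k (Y k x)) \<le> ?d * (y k * norm x)"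
    proof -
      have "0 \<le> ?d" using y_mono[of k] by simp
      then show ?thesis
        using Suc[of "Y k x"] mult_left_mono[OF bound[of k x]] by (meson order_trans)
    qed
    ultimately have "2 * norm (Y (Suc (Suc k)) x - Y (Suc k) x)
        \<le> y (Suc k) * (?d * norm x) + ?d * (y k * norm x)"
      unfolding eq by (intro norm_triangle_le) simp
    also have "\<dots> = ((y (Suc k))\<^sup>2 - (y k)\<^sup>2) * norm x"
      by (simp add: power2_eq_square algebra_simps)
    also have "(y (Suc k))\<^sup>2 - (y k)\<^sup>2 = 2 * (y (Suc (Suc k)) - y (Suc k))"
      using yS[of k] yS[of "Suc k"] by simp
    finally show ?case by (simp only: mult.assoc mult_le_cancel_left_pos zero_less_numeral)
  qed
  have far: "norm (Y l x - Y k x) \<le> (y l - y k) * norm x" if "k \<le> l" for k l x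
    using that
  proof (induction l rule: dec_induct)
    case (step n)
    have "norm (Y (Suc n) x - Y k x) \<le> norm (Y (Suc n) x - Y n x) + norm (Y n x - Y k x)"
      using norm_triangle_ineq[of "Y (Suc n) x - Y n x" "Y n x - Y k x"] by simp
    with step.IH consecutive[of n x]
    show ?case by (simp add: algebra_simps)
  qed simp
  have "convergent y"
    by (rule Bseq_mono_convergent[OF BseqI'[where K = 1]])
       (use y_le y_nonneg y_mono in \<open>auto simp: incseq_SucI mono_iff_le_Suc intro: lift_Suc_mono_le\<close>)
  then have "Cauchy y" by (simp add: Cauchy_convergent_iff)
  have "Cauchy (\<lambda>k. Y k x)" for x
  proof (rule metric_CauchyI)
    fix e :: real assume "0 < e"
    define d where "d = e / (norm x + 1)"
    have "0 < norm x + 1" by (simp add: add_nonneg_pos)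
    then have d: "0 < d" "d * norm x < e"
      using \<open>0 < e\<close> by (auto simp: d_def field_simps)
    obtain N where N: "\<And>k l. N \<le> k \<Longrightarrow> N \<le> l \<Longrightarrow> dist (y k) (y l) < d"
      using metric_CauchyD[OF \<open>Cauchy y\<close> d(1)] by blast
    have "norm (Y l x - Y k x) < e" if "N \<le> k" "k \<le> l" for k l
    proof -
      have "y l - y k \<le> d" using N[of k l] that by (auto simp: dist_real_def)
      then have "(y l - y k) * norm x \<le> d * norm x" by (intro mult_right_mono) auto
      then show ?thesis using far[OF that(2), of x] d(2) by linarith
    qed
    then have "\<forall>k\<ge>N. \<forall>l\<ge>N. dist (Y k x) (Y l x) < e"
      by (metis dist_norm nat_le_linear norm_minus_commute)
    then show "\<exists>N. \<forall>k\<ge>N. \<forall>l\<ge>N. dist (Y k x) (Y l x) < e" by blast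
  qed
  then obtain R where R: "\<And>x. (\<lambda>k. Y k x) \<longlonglongrightarrow> R x"
    unfolding Cauchy_convergent_iff convergent_def by metis
  have R_le: "norm (R x) \<le> norm x" for x
  proof (rule LIMSEQ_le_const2[OF tendsto_norm[OF R]])
    have "norm (Y k x) \<le> norm x" for k
      using bound[of k x] mult_right_mono[OF y_le[of k] norm_ge_zero[of x]] by simp
    then show "\<exists>N. \<forall>n\<ge>N. norm (Y n x) \<le> norm x" by blast
  qed
  have R_lin: "bounded_clinear R"
  proof (rule bounded_clinearI[where C = 1])
    show "R (a + b) = R a + R b" for a b
      by (rule LIMSEQ_unique[OF R]) (simp add: bounded_clinear_add[OF lin] tendsto_add R)
    show "R (c *\<^sub>C a) = c *\<^sub>C R a" for c a
      by (rule LIMSEQ_unique[OF R])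
         (simp add: bounded_clinear_scaleC[OF lin]
           bounded_clinear_tendsto[OF bounded_clinear_scaled[OF bounded_clinear_ident]] R)
  qed (simp add: R_le)
  have Y_sa: "cinner (Y k a) b = cinner a (Y k b)" for k a b
    by (induction k arbitrary: a b) (simp_all add: Y0 YS cinner_simps sa)
  have R_sa: "cinner (R a) b = cinner a (R b)" for a b
    by (rule LIMSEQ_unique[OF tendsto_cinner_left[OF R]])
       (simp add: Y_sa tendsto_cinner_right[OF R])
  have R_fix: "2 *\<^sub>C R x = C x + R (R x)" for x
  proof -
    have "(\<lambda>k. Y k (Y k x - R x)) \<longlonglongrightarrow> 0"
    proof (rule tendsto_norm_zero_cancel, rule tendsto_sandwich[OF _ _ tendsto_const])
      have "norm (Y k (Y k x - R x)) \<le> norm (Y k x - R x)" for k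
        using bound[of k "Y k x - R x"] mult_right_mono[OF y_le[of k] norm_ge_zero[of "Y k x - R x"]]
        by simp
      then show "\<forall>\<^sub>F k in sequentially. norm (Y k (Y k x - R x)) \<le> norm (Y k x - R x)" by simp
      show "(\<lambda>k. norm (Y k x - R x)) \<longlonglongrightarrow> 0"
        using R[of x] by (intro tendsto_norm_zero) (simp add: LIM_zero)
    qed simp
    from tendsto_add[OF this R[of "R x"]] have "(\<lambda>k. Y k (Y k x)) \<longlonglongrightarrow> R (R x)"
      by (simp add: bounded_clinear_diff[OF lin])
    then have "(\<lambda>k. C x + Y k (Y k x)) \<longlonglongrightarrow> C x + R (R x)"
      by (intro tendsto_intros)
    moreover have "(\<lambda>k. 2 *\<^sub>C Y (Suc k) x) \<longlonglongrightarrow> 2 *\<^sub>C R x"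
      by (intro bounded_clinear_tendsto[OF bounded_clinear_scaled[OF bounded_clinear_ident]]
          LIMSEQ_Suc R)
    moreover have "2 *\<^sub>C Y (Suc k) x = C x + Y k (Y k x)" for k
      by (simp add: YS scaleC_scaleC)
    ultimately show ?thesis by (metis (no_types, lifting) LIMSEQ_unique ext)
  qed
  have "positive_operator (\<lambda>x. x - R x)"
    unfolding positive_operator_def
  proof (intro conjI allI)
    show "bounded_clinear (\<lambda>x. x - R x)"
      by (intro bounded_clinear_sub R_lin bounded_clinear_ident)
    fix x
    have "cinner (R x) x = cnj (cinner (R x) x)"
      using R_sa[of x x] by (metis cinner_commute)
    then have "Im (cinner (R x) x) = Im (cnj (cinner (R x) x))" by (rule arg_cong)
    moreover have "Re (cinner (R x) x) \<le> (norm x)\<^sup>2"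
    proof -
      have "Re (cinner (R x) x) \<le> norm (R x) * norm x"
        using complex_Re_le_cmod cinner_Cauchy_Schwarz order_trans by blast
      also have "\<dots> \<le> norm x * norm x" by (intro mult_right_mono R_le) simp
      finally show ?thesis by (simp add: power2_eq_square)
    qed
    ultimately show "cinner (x - R x) x \<in> \<real>\<^sub>\<ge>\<^sub>0"
      unfolding complex_nonneg_Reals_iff cinner_diff_left cinner_self[of x] minus_complex.simps
        Re_complex_of_real Im_complex_of_real by simp
  qed
  moreover have "(\<lambda>x. x - R x) \<circ> (\<lambda>x. x - R x) = (\<lambda>x. x - C x)"
  proof
    fix x
    have "R x + R x = C x + R (R x)"
      using R_fix[of x] scaleC_add_left[of 1 1 "R x"] by simp
    then show "((\<lambda>x. x - R x) \<circ> (\<lambda>x. x - R x)) x = x - C x"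
      by (simp add: bounded_clinear_diff[OF R_lin] algebra_simps)
  qed
  moreover have "Z (x - R x) = Z x - R (Z x)"
    if Z: "bounded_clinear Z" and ZC: "\<And>x. Z (C x) = C (Z x)" for Z x
  proof -
    have "Z (Y k x) = Y k (Z x)" for k x
      by (induction k arbitrary: x)
         (simp_all add: Y0 YS bounded_clinear_zero[OF Z] bounded_clinear_scaleC[OF Z]
           bounded_clinear_add[OF Z] ZC)
    then have "Z (R x) = R (Z x)"
      using bounded_clinear_tendsto[OF Z R[of x]] R[of "Z x"] by (auto intro: LIMSEQ_unique)
    then show ?thesis by (simp add: bounded_clinear_diff[OF Z])
  qed
  ultimately show ?thesis
    by (intro exI[of _ "\<lambda>x. x - R x"]) blast
qed

text \<open>
  For the selfadjoint difference \<open>S = B - B'\<close> the commuting roots satisfy \<open>(B + B') S = B\<^sup>2 - B'\<^sup>2 = 0\<close>. Both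
  summands of the resulting quadratic form are nonnegative, so both vanish, hence so does the form of
  \<open>S\<^sup>3\<close>. Then \<open>S\<^sup>3 = 0\<close>, and a selfadjoint nilpotent operator is zero.
\<close>

lemma positive_square_root_unique:
  fixes B B' :: "'a::complex_hilbert \<Rightarrow> 'a"
  assumes pos: "positive_operator B" "positive_operator B'" and eq: "\<And>x. B (B x) = B' (B' x)"
    and comm: "\<And>x. B' (B x) = B (B' x)"
  shows "B = B'"
proof
  fix x
  define S where "S = (\<lambda>x. B x - B' x)"
  have B: "bounded_clinear B" and B': "bounded_clinear B'"
    using pos by (auto simp: positive_operator_def)
  have S: "bounded_clinear S" unfolding S_def by (intro bounded_clinear_sub B B')
  have S_sa: "cinner (S x) y = cinner x (S y)" for x y
    by (simp add: S_def cinner_diff_left cinner_diff_right positive_operator_selfadjoint[OF pos(1)]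
        positive_operator_selfadjoint[OF pos(2)])
  have "cinner (S (S (S x))) x = 0" for x
  proof -
    have "B (S x) + B' (S x) = 0"
      by (simp add: S_def bounded_clinear_diff[OF B] bounded_clinear_diff[OF B'] eq comm)
    then have "cinner (B (S x)) (S x) + cinner (B' (S x)) (S x) = 0"
      by (simp flip: cinner_add_left)
    moreover have "cinner (B (S x)) (S x) \<in> \<real>\<^sub>\<ge>\<^sub>0" "cinner (B' (S x)) (S x) \<in> \<real>\<^sub>\<ge>\<^sub>0"
      using pos by (auto simp: positive_operator_def)
    ultimately have "cinner (B (S x)) (S x) = 0" "cinner (B' (S x)) (S x) = 0"
      by (auto simp: complex_nonneg_Reals_iff complex_eq_iff)
    then have "cinner (S (S x)) (S x) = 0"
      by (subst (1) S_def) (simp add: cinner_diff_left)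
    then show ?thesis by (simp add: S_sa)
  qed
  then have "S (S (S x)) = 0" for x
    using cinner_polarization[OF bounded_clinear_compose[OF S bounded_clinear_compose[OF S S]]]
    by blast
  then have "cinner (S (S x)) (S (S x)) = 0" for x
    using S_sa[of "S (S x)" "S x"] by simp
  then have "cinner (S x) (S x) = 0" using S_sa[of "S x" x] by simp
  then show "B x = B' x" by (simp add: S_def)
qed

lemma op_sqrt:
  fixes C :: "'a::complex_hilbert \<Rightarrow> 'a"
  assumes C: "bounded_clinear C" and le: "\<And>x. norm (C x) \<le> norm x"
    and sa: "\<And>x y. cinner (C x) y = cinner x (C y)"
  shows "positive_operator (op_sqrt (\<lambda>x. x - C x)) \<and>
    (\<forall>x. op_sqrt (\<lambda>x. x - C x) (op_sqrt (\<lambda>x. x - C x) x) = x - C x)"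
proof -
  obtain B where Bex: "positive_operator B \<and> B \<circ> B = (\<lambda>x. x - C x) \<and>
    (\<forall>Z. bounded_clinear Z \<longrightarrow> (\<forall>x. Z (C x) = C (Z x)) \<longrightarrow> (\<forall>x. Z (B x) = B (Z x)))"
    using positive_square_root_exists[OF assms] by (rule exE)
  note B = Bex[THEN conjunct1] Bex[THEN conjunct2, THEN conjunct1]
  have comm: "Z (B x) = B (Z x)" if "bounded_clinear Z" "\<And>x. Z (C x) = C (Z x)" for Z x
    using Bex that by blast
  have BB: "B (B x) = x - C x" for x using B(2) by (metis comp_apply)
  have "op_sqrt (\<lambda>x. x - C x) = B"
    unfolding op_sqrt_def
  proof (rule the_equality)
    fix B' assume B': "positive_operator B' \<and> B' \<circ> B' = (\<lambda>x. x - C x)"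
    then have lin: "bounded_clinear B'" by (simp add: positive_operator_def)
    have BB': "B' (B' x) = x - C x" for x using B' by (metis comp_apply)
    have "B' (C x) = C (B' x)" for x
    proof -
      have "B' (x - C x) = B' x - C (B' x)" by (metis BB')
      then show ?thesis by (simp add: bounded_clinear_diff[OF lin])
    qed
    then show "B' = B"
      using positive_square_root_unique[of B B'] B B' BB BB' comm[OF lin] by simp
  qed (use B in simp)
  then show ?thesis using B BB by simp
qed

context
  fixes T :: "'a::complex_hilbert \<Rightarrow> 'a"
  assumes T: "contraction T"
begin

lemma contraction_bounded_clinear: "bounded_clinear T"
  and contraction_norm_le: "norm (T x) \<le> norm x"
  using T by (auto simp: contraction_def)

lemma contraction_cadjoint: "contraction (cadjoint T)"
  unfolding contraction_def
proof (intro conjI allI bounded_clinear_cadjoint contraction_bounded_clinear)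
  fix h
  show "norm (cadjoint T h) \<le> norm h"
  proof (rule norm_le_by_cinner)
    fix y
    have "cmod (cinner (cadjoint T h) y) \<le> norm h * norm (T y)"
      unfolding cinner_cadjoint'[OF contraction_bounded_clinear] by (rule cinner_Cauchy_Schwarz)
    also have "\<dots> \<le> norm h * norm y"
      by (intro mult_left_mono contraction_norm_le) simp
    finally show "cmod (cinner (cadjoint T h) y) \<le> norm h * norm y" .
  qed simp
qed

lemma cadjoint_cadjoint: "cadjoint (cadjoint T) = T"
proof
  fix x
  show "cadjoint (cadjoint T) x = T x"
    by (rule cinner_ext)
       (metis cinner_cadjoint cinner_cadjoint' contraction_bounded_clinear contraction_cadjoint
         contraction_def)
qed

lemma defect_positive: "positive_operator (defect T)"
  and defect_defect: "defect T (defect T x) = x - cadjoint T (T x)"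
proof -
  note lin = contraction_bounded_clinear
  have "bounded_clinear (\<lambda>x. cadjoint T (T x))"
    by (rule bounded_clinear_compose[OF bounded_clinear_cadjoint[OF lin] lin])
  moreover have "norm (cadjoint T (T x)) \<le> norm x" for x
    using contraction_cadjoint contraction_norm_le[of x] order_trans
    by (fastforce simp: contraction_def)
  moreover have "cinner (cadjoint T (T x)) y = cinner x (cadjoint T (T y))" for x y
    by (simp add: cinner_cadjoint'[OF lin] cinner_cadjoint[OF lin])
  ultimately show "positive_operator (defect T)" "defect T (defect T x) = x - cadjoint T (T x)"
    using op_sqrt[of "\<lambda>x. cadjoint T (T x)"] unfolding defect_def by auto
qed

lemma bounded_clinear_defect: "bounded_clinear (defect T)"
  using defect_positive by (simp add: positive_operator_def)

lemma defect_selfadjoint: "cinner (defect T x) y = cinner x (defect T y)"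
  by (rule positive_operator_selfadjoint[OF defect_positive])

lemma norm_defect: "(norm (defect T x))\<^sup>2 = (norm x)\<^sup>2 - (norm (T x))\<^sup>2"
proof -
  have "complex_of_real ((norm (defect T x))\<^sup>2) = cinner x (defect T (defect T x))"
    by (simp only: cinner_self[symmetric] defect_selfadjoint)
  also have "\<dots> = cinner x x - cinner (T x) (T x)"
    by (simp add: defect_defect cinner_diff_right cinner_cadjoint[OF contraction_bounded_clinear])
  also have "\<dots> = complex_of_real ((norm x)\<^sup>2 - (norm (T x))\<^sup>2)"
    by (simp add: cinner_self)
  finally show ?thesis unfolding of_real_eq_iff .
qed

lemma defect_eq_0_iff: "defect T x = 0 \<longleftrightarrow> norm (T x) = norm x"
proof -
  have "defect T x = 0 \<longleftrightarrow> (norm (defect T x))\<^sup>2 = 0" by simp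
  also have "\<dots> \<longleftrightarrow> (norm (T x))\<^sup>2 = (norm x)\<^sup>2"
    unfolding norm_defect by auto
  also have "\<dots> \<longleftrightarrow> norm (T x) = norm x" by simp
  finally show ?thesis .
qed

text \<open>
  The isometric part consists of the vectors whose whole orbit is killed by the defect operator; in this
  form it can be compared with the Taylor coefficients of the characteristic function.
\<close>

lemma isometric_part_iff: "h \<in> isometric_part T \<longleftrightarrow> (\<forall>k. defect T ((T ^^ k) h) = 0)"
  by (simp add: isometric_part_def defect_eq_0_iff)

lemma defect_star_eq: "defect_star T = defect (cadjoint T)"
  by (simp add: defect_star_def defect_def cadjoint_cadjoint)

lemma defect_star_space_eq: "defect_star_space T = defect_space (cadjoint T)"
  by (simp add: defect_star_space_def defect_space_def defect_star_eq)

lemma cinner_funpow_cadjoint: "cinner ((T ^^ k) x) y = cinner x ((cadjoint T ^^ k) y)"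
  by (induction k arbitrary: x) (simp_all add: cinner_cadjoint[OF contraction_bounded_clinear] funpow_swap1)

end

section \<open>The coefficients of the characteristic function\<close>

lemma powser_eq_0_imp_coeff_eq_0:
  fixes c :: "nat \<Rightarrow> complex"
  assumes "\<And>z. cmod z < 1 \<Longrightarrow> (\<lambda>k. c k * z ^ k) sums 0"
  shows "c k = 0"
proof -
  have "summable (\<lambda>k. c k * (1/2) ^ k)"
    using assms[of "1/2"] by (simp add: sums_iff)
  from conv_radius_geI[OF this] have r: "0 < conv_radius c"
    by (rule less_le_trans[rotated]) simp
  have "Abs_fps c = 0"
  proof (rule eval_fps_eqD)
    show "0 < fps_conv_radius (Abs_fps c)" using r by (simp add: fps_conv_radius_def)
    have "eventually (\<lambda>z. z \<in> ball (0::complex) 1) (nhds 0)"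
      by (rule eventually_nhds_in_open) auto
    then show "eventually (\<lambda>z. eval_fps (Abs_fps c) z = eval_fps 0 z) (nhds 0)"
      by eventually_elim (use assms in \<open>simp add: eval_fps_def sums_iff\<close>)
  qed simp
  then have "fps_nth (Abs_fps c) k = fps_nth 0 k" by (rule arg_cong)
  then show ?thesis by simp
qed

lemma norm_funpow_le:
  fixes S :: "'a::real_normed_vector \<Rightarrow> 'a"
  assumes "\<And>x. norm (S x) \<le> norm x"
  shows "norm ((S ^^ k) x) \<le> norm x"
  by (induction k) (auto intro: order_trans[OF assms])

text \<open>
  The geometric series converges because \<open>\<bar>z\<bar> < 1\<close> and the powers of \<open>S\<close> are contractions; the same
  estimate shows that \<open>I - zS\<close> is injective, so that the inverse function picks out the sum.
\<close>

lemma Neumann_series: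
  fixes S :: "'a::complex_hilbert \<Rightarrow> 'a"
  assumes S: "bounded_clinear S" and le: "\<And>x. norm (S x) \<le> norm x" and z: "cmod z < 1"
  shows "(\<lambda>k. z ^ k *\<^sub>C (S ^^ k) h) sums (inv (\<lambda>g. g - z *\<^sub>C S g) h)"
proof -
  let ?f = "\<lambda>k. z ^ k *\<^sub>C (S ^^ k) h"
  have "summable ?f"
  proof (rule summable_comparison_test)
    have "norm (?f k) \<le> cmod z ^ k * norm h" for k
      by (simp add: norm_power mult_left_mono norm_funpow_le[OF le])
    then show "\<exists>N. \<forall>n\<ge>N. norm (?f n) \<le> cmod z ^ n * norm h" by blast
    show "summable (\<lambda>n. cmod z ^ n * norm h)"
      using z by (intro summable_mult2 summable_geometric) simp
  qed
  then obtain g where g: "?f sums g" by (auto simp: summable_def)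
  have "(\<lambda>k. z *\<^sub>C S (?f k)) sums (z *\<^sub>C S g)"
    by (rule bounded_linear.sums[OF bounded_clinear_bounded_linear[OF bounded_clinear_scaled[OF S]] g])
  then have "(\<lambda>k. ?f (Suc k)) sums (z *\<^sub>C S g)"
    by (simp add: bounded_clinear_scaleC[OF S] scaleC_scaleC)
  then have "?f sums (z *\<^sub>C S g + ?f 0)" by (rule sums_Suc)
  then have "g = z *\<^sub>C S g + ?f 0" by (rule sums_unique2[OF g])
  then have "g - z *\<^sub>C S g = ?f 0" by (metis add_diff_cancel_left')
  then have gh: "g - z *\<^sub>C S g = h" by simp
  have "inj (\<lambda>g. g - z *\<^sub>C S g)"
  proof (rule injI)
    fix a b assume ab: "a - z *\<^sub>C S a = b - z *\<^sub>C S b"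
    have "a - b = A - B" if "a - A = b - B" for A B
      using that by (simp add: algebra_simps)
    from this[OF ab] have "a - b = z *\<^sub>C S a - z *\<^sub>C S b" .
    also have "\<dots> = z *\<^sub>C S (a - b)"
      by (simp only: bounded_clinear_diff[OF S] complex_vector.scale_right_diff_distrib)
    finally have "norm (a - b) = norm (z *\<^sub>C S (a - b))" by (rule arg_cong)
    then have "norm (a - b) = cmod z * norm (S (a - b))" by (simp only: norm_scaleC)
    also have "\<dots> \<le> cmod z * norm (a - b)" by (intro mult_left_mono le) simp
    finally have "(1 - cmod z) * norm (a - b) \<le> 0" by (simp add: algebra_simps)
    then have "norm (a - b) = 0" using z by (simp add: mult_le_0_iff)
    then show "a = b" by simp
  qed
  then have "inv (\<lambda>g. g - z *\<^sub>C S g) h = g" by (rule inv_f_eq) (rule gh)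
  then show ?thesis using g by simp
qed

context
  fixes T :: "'a::complex_hilbert \<Rightarrow> 'a"
  assumes T: "contraction T"
begin

text \<open>
  Inserting the Neumann series of \<open>(I - zT*)\<^sup>-\<^sup>1\<close> exhibits the Taylor coefficient of degree \<open>j + 1\<close> as
  \<open>D\<^sub>T\<^sub>* T*\<^sup>j D\<^sub>T\<close>.
\<close>

lemma char_fun_sums:
  assumes z: "cmod z < 1"
  shows "(\<lambda>k. (case k of 0 \<Rightarrow> - cinner (T h) y
      | Suc j \<Rightarrow> cinner (defect_star T ((cadjoint T ^^ j) (defect T h))) y) * z ^ k)
    sums cinner (char_fun T z h) y"
proof -
  let ?D = "defect_star T"
  have D: "bounded_clinear ?D"
    unfolding defect_star_eq[OF T] by (rule bounded_clinear_defect[OF contraction_cadjoint[OF T]])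
  have "bounded_linear (\<lambda>g. cinner (z *\<^sub>C ?D g) y)"
    by (rule bounded_linear_compose[OF bounded_linear_cinner_left
          bounded_clinear_bounded_linear[OF bounded_clinear_scaled[OF D]]])
  from bounded_linear.sums[OF this Neumann_series[OF contraction_bounded_clinear[OF contraction_cadjoint[OF T]] contraction_norm_le[OF contraction_cadjoint[OF T]] z, of "defect T h"]]
  have "(\<lambda>k. cinner (?D ((cadjoint T ^^ k) (defect T h))) y * z ^ Suc k)
    sums cinner (z *\<^sub>C ?D (inv (\<lambda>g. g - z *\<^sub>C cadjoint T g) (defect T h))) y"
    by (simp add: bounded_clinear_scaleC[OF D] scaleC_scaleC cinner_scaleC_left mult_ac)
  then have "(\<lambda>k. (case Suc k of 0 \<Rightarrow> - cinner (T h) y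
      | Suc j \<Rightarrow> cinner (?D ((cadjoint T ^^ j) (defect T h))) y) * z ^ Suc k)
    sums cinner (z *\<^sub>C ?D (inv (\<lambda>g. g - z *\<^sub>C cadjoint T g) (defect T h))) y"
    by simp
  from sums_Suc[OF this] show ?thesis
    by (simp add: char_fun_def cinner_add_left cinner_minus_left add.commute cinner_diff_left)
qed

text \<open>
  The coefficient of degree \<open>k + 1 > n\<close> of a polynomial of degree \<open>n\<close> is zero. The operator identity is
  read off from the scalar power series obtained by pairing with a fixed vector.
\<close>

lemma char_fun_coefficients_vanish:
  assumes poly: "operator_polynomial (defect_space T) L n (char_fun T)" and k: "n \<le> k"
    and h: "h \<in> defect_space T"
  shows "defect_star T ((cadjoint T ^^ k) (defect T h)) = 0"
proof -
  obtain A where A: "\<And>z. z \<in> ball 0 1 \<Longrightarrow> char_fun T z h = (\<Sum>k\<le>n. z ^ k *\<^sub>C A k h)"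
    using poly h unfolding operator_polynomial_def by blast
  have "cinner (defect_star T ((cadjoint T ^^ k) (defect T h))) y = 0" for y
  proof -
    define b where "b k = (case k of 0 \<Rightarrow> - cinner (T h) y
      | Suc j \<Rightarrow> cinner (defect_star T ((cadjoint T ^^ j) (defect T h))) y)" for k
    define a where "a k = (if k \<le> n then cinner (A k h) y else 0)" for k
    have "(\<lambda>k. (b k - a k) * z ^ k) sums 0" if z: "cmod z < 1" for z
    proof -
      have "cinner (char_fun T z h) y = (\<Sum>k\<le>n. a k * z ^ k)"
        using A[of z] z by (simp add: cinner_sum_left cinner_scaleC_left a_def mult.commute)
      moreover have "(\<lambda>k. a k * z ^ k) sums (\<Sum>k\<le>n. a k * z ^ k)"
        by (rule sums_finite) (auto simp: a_def)
      moreover have "(\<lambda>k. b k * z ^ k) sums cinner (char_fun T z h) y"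
        using char_fun_sums[OF z, of h y] by (simp add: b_def)
      ultimately show ?thesis
        using sums_diff by (fastforce simp: left_diff_distrib)
    qed
    from powser_eq_0_imp_coeff_eq_0[OF this, of "Suc k"] show ?thesis
      using k by (simp add: a_def b_def)
  qed
  from this[of "defect_star T ((cadjoint T ^^ k) (defect T h))"] show ?thesis by simp
qed

lemma cinner_defect_funpow:
  "cinner (defect T ((T ^^ k) x)) y = cinner x ((cadjoint T ^^ k) (defect T y))"
  by (simp add: defect_selfadjoint[OF T] cinner_funpow_cadjoint[OF T])

text \<open>
  The vanishing of the coefficients is known on the defect space only. Taking adjoints, it gives for
  \<open>v = T\<^sup>k D\<^sub>T\<^sub>* y\<close> the relation \<open>D\<^sub>T D\<^sub>T v = 0\<close>, from which \<open>D\<^sub>T v = 0\<close> because \<open>D\<^sub>T\<close> is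
  selfadjoint.
\<close>

lemma defect_funpow_defect_star_eq_0:
  assumes poly: "operator_polynomial (defect_space T) L n (char_fun T)" and k: "n \<le> k"
  shows "defect T ((T ^^ k) (defect_star T y)) = 0"
proof -
  define v where "v = (T ^^ k) (defect_star T y)"
  have star: "cinner (defect_star T a) b = cinner a (defect_star T b)" for a b
    unfolding defect_star_eq[OF T] by (rule defect_selfadjoint[OF contraction_cadjoint[OF T]])
  have "cinner (defect T (defect T v)) x = 0" for x
  proof -
    have "defect T x \<in> defect_space T"
      unfolding defect_space_def by (rule closure_subset[THEN subsetD]) simp
    then have "defect_star T ((cadjoint T ^^ k) (defect T (defect T x))) = 0"
      by (rule char_fun_coefficients_vanish[OF poly k])
    then show ?thesis
      by (simp add: v_def defect_selfadjoint[OF T] cinner_funpow_cadjoint[OF T] star)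
  qed
  from this[of v] have "cinner (defect T v) (defect T v) = 0"
    by (simp add: defect_selfadjoint[OF T])
  then show ?thesis by (simp add: v_def)
qed

lemma defect_star_funpow_defect_eq_0:
  assumes "\<And>y. defect T ((T ^^ k) (defect (cadjoint T) y)) = 0"
  shows "defect (cadjoint T) ((cadjoint T ^^ k) (defect T x)) = 0"
proof -
  have "cinner (defect T ((T ^^ k) (defect (cadjoint T) y))) x =
      cinner y (defect (cadjoint T) ((cadjoint T ^^ k) (defect T x)))" for y
    by (simp add: cinner_defect_funpow defect_selfadjoint[OF contraction_cadjoint[OF T]])
  then show ?thesis using assms by (metis cinner_self_eq_0_iff cinner_zero_left)
qed

end

section \<open>The isometric parts and the central spaces\<close>

context
  fixes T :: "'a::complex_hilbert \<Rightarrow> 'a"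
  assumes T: "contraction T"
begin

text \<open>
  Moving the powers of \<open>T\<close> to the other side gives \<open>T*\<^sup>k y\<close>, which \<open>D\<^sub>T\<^sub>*\<close> annihilates.
\<close>

lemma orbit_span_orthogonal:
  assumes x: "x \<in> orbit_span T (defect_star_space T) n" and y: "y \<in> isometric_part (cadjoint T)"
  shows "cinner x y = 0"
proof -
  have "cinner ((T ^^ k) h) y = 0" if "h \<in> defect_star_space T" for k h
  proof -
    have "cinner h ((cadjoint T ^^ k) y) = 0"
      using that unfolding defect_star_space_eq[OF T] defect_space_def
    proof (rule closure_orthogonal)
      fix s assume "s \<in> range (defect (cadjoint T))"
      then obtain a where "s = defect (cadjoint T) a" by blast
      then show "cinner s ((cadjoint T ^^ k) y) = 0"
        using y by (simp add: defect_selfadjoint[OF contraction_cadjoint[OF T]]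
            isometric_part_iff[OF contraction_cadjoint[OF T]])
    qed
    then show ?thesis by (simp add: cinner_funpow_cadjoint[OF T])
  qed
  then have "complex_vector.span {(T ^^ k) h |k h. h \<in> defect_star_space T \<and> k \<ge> n} \<subseteq> {x. cinner x y = 0}"
    by (intro complex_vector.span_minimal) (auto simp: complex_vector.subspace_def cinner_simps)
  then show ?thesis
    using closure_orthogonal[OF x[unfolded orbit_span_def], of y] by blast
qed

context
  fixes n :: nat
  assumes vanish: "\<And>k y. n \<le> k \<Longrightarrow> defect T ((T ^^ k) (defect (cadjoint T) y)) = 0"
begin

text \<open>
  By the vanishing coefficients, the orbit of every generator consists of vectors on which \<open>T\<close> preserves the
  norm.
\<close>

lemma orbit_span_subset_isometric_part:
  "orbit_span T (defect_star_space T) n \<subseteq> isometric_part T"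
proof -
  have iso: "closed_csubspace (isometric_part T)" by (rule isometric_part_maximal(1)[OF T])
  have "(T ^^ k) h \<in> isometric_part T" if h: "h \<in> defect_star_space T" and k: "n \<le> k" for h k
  proof -
    have "range (defect (cadjoint T)) \<subseteq> {h. (T ^^ k) h \<in> isometric_part T}"
    proof clarify
      fix y
      have "defect T ((T ^^ j) ((T ^^ k) (defect (cadjoint T) y))) = 0" for j
        using vanish[of "j + k" y] k by (simp add: funpow_add)
      then show "(T ^^ k) (defect (cadjoint T) y) \<in> isometric_part T"
        by (simp add: isometric_part_iff[OF T])
    qed
    moreover have "closed {h. (T ^^ k) h \<in> isometric_part T}"
      using closed_csubspace_vimage[OF bounded_clinear_funpow[OF contraction_bounded_clinear[OF T]] iso]
      by (simp add: closed_csubspace_def)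
    ultimately have "defect_star_space T \<subseteq> {h. (T ^^ k) h \<in> isometric_part T}"
      unfolding defect_star_space_eq[OF T] defect_space_def by (rule closure_minimal)
    then show ?thesis using h by blast
  qed
  then show ?thesis
    using iso unfolding orbit_span_def closed_csubspace_def
    by (intro closure_minimal complex_vector.span_minimal) auto
qed

text \<open>
  The adjoint of \<open>D\<^sub>T T\<^sup>j\<^sup>+\<^sup>n\<close> maps into the isometric part of \<open>T*\<close>, which is orthogonal to \<open>b\<close>. This is
  where the nilpotency of the central entries comes from.
\<close>

lemma funpow_in_isometric_part:
  assumes b: "\<And>q. q \<in> isometric_part (cadjoint T) \<Longrightarrow> cinner b q = 0"
  shows "(T ^^ n) b \<in> isometric_part T"
  unfolding isometric_part_iff[OF T]
proof
  fix j
  let ?w = "defect T ((T ^^ j) ((T ^^ n) b))"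
  have "(cadjoint T ^^ (j + n)) (defect T ?w) \<in> isometric_part (cadjoint T)"
    unfolding isometric_part_iff[OF contraction_cadjoint[OF T]]
  proof
    fix i
    have "defect (cadjoint T) ((cadjoint T ^^ (i + (j + n))) (defect T ?w)) = 0"
      by (rule defect_star_funpow_defect_eq_0[OF T vanish]) simp
    then show "defect (cadjoint T) ((cadjoint T ^^ i) ((cadjoint T ^^ (j + n)) (defect T ?w))) = 0"
      by (simp only: funpow_add[of i] comp_apply)
  qed
  then have "cinner (defect T ((T ^^ (j + n)) b)) ?w = 0"
    unfolding cinner_defect_funpow[OF T] by (rule b)
  then have "cinner ?w ?w = 0" by (simp add: funpow_add)
  then show "?w = 0" by simp
qed

end

end

text \<open>
  Since \<open>H \<subseteq> P \<inter> Q\<^sup>\<bottom>\<close>, removing \<open>H\<close>, \<open>Q\<close> and then the rest of \<open>P\<close> is the same as removing from \<open>Q\<^sup>\<bottom>\<close> its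
  whole intersection with \<open>P\<close>. The two central spaces of the modified decompositions thus no longer
  depend on the orbit spans.
\<close>

lemma central_space_eq:
  fixes P Q H W :: "'a::complex_hilbert set"
  assumes P: "closed_csubspace P" and H: "closed_csubspace H" "H \<subseteq> P"
    and HQ: "\<And>h q. h \<in> H \<Longrightarrow> q \<in> Q \<Longrightarrow> cinner h q = 0"
    and W: "\<And>x. x \<in> W \<longleftrightarrow> (\<forall>h\<in>H. cinner x h = 0) \<and> (\<forall>q\<in>Q. cinner x q = 0)"
  shows "W \<ominus> (P \<inter> W) = (UNIV \<ominus> Q) \<ominus> (P \<inter> (UNIV \<ominus> Q))"
proof (intro set_eqI iffI)
  fix x assume "x \<in> W \<ominus> (P \<inter> W)"
  then have x: "x \<in> W" and orth: "\<And>y. y \<in> P \<Longrightarrow> y \<in> W \<Longrightarrow> cinner x y = 0"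
    by (auto simp: orth_diff_def)
  have "cinner x a = 0" if a: "a \<in> P" "\<And>q. q \<in> Q \<Longrightarrow> cinner a q = 0" for a
  proof -
    let ?h = "orth_proj H a"
    have h: "?h \<in> H" by (rule orth_proj_in[OF H(1)])
    have "a - ?h \<in> W"
      unfolding W
    proof (intro conjI ballI)
      show "cinner (a - ?h) y = 0" if "y \<in> H" for y by (rule cinner_diff_orth_proj[OF H(1) that])
      show "cinner (a - ?h) q = 0" if "q \<in> Q" for q
        by (simp add: cinner_diff_left a(2)[OF that] HQ[OF h that])
    qed
    moreover have "a - ?h \<in> P" by (rule closed_csubspace_diff[OF P a(1)]) (use h H(2) in blast)
    ultimately have "cinner x (a - ?h) = 0" by (intro orth)
    moreover have "cinner x ?h = 0" using x h by (simp add: W)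
    ultimately show ?thesis by (simp add: cinner_diff_right)
  qed
  then show "x \<in> (UNIV \<ominus> Q) \<ominus> (P \<inter> (UNIV \<ominus> Q))"
    using x by (auto simp: orth_diff_def W)
next
  fix x assume "x \<in> (UNIV \<ominus> Q) \<ominus> (P \<inter> (UNIV \<ominus> Q))"
  then have xQ: "\<And>q. q \<in> Q \<Longrightarrow> cinner x q = 0"
    and orth: "\<And>a. a \<in> P \<Longrightarrow> (\<And>q. q \<in> Q \<Longrightarrow> cinner a q = 0) \<Longrightarrow> cinner x a = 0"
    by (auto simp: orth_diff_def)
  have "cinner x h = 0" if "h \<in> H" for h
    using that H(2) by (intro orth HQ) auto
  then have "x \<in> W" using xQ by (simp add: W)
  moreover have "cinner x a = 0" if "a \<in> P \<inter> W" for a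
    using that by (intro orth) (auto simp: W)
  ultimately show "x \<in> W \<ominus> (P \<inter> W)" by (simp add: orth_diff_def)
qed

section \<open>Finite-dimensional sets\<close>

definition finite_dimensional :: "'a::complex_inner set \<Rightarrow> bool"
  where "finite_dimensional V \<longleftrightarrow> (\<exists>B. finite B \<and> V \<subseteq> complex_vector.span B)"

lemma subspace_image:
  assumes "bounded_clinear f" "complex_vector.subspace S"
  shows "complex_vector.subspace (f ` S)"
  unfolding complex_vector.subspace_def
proof (intro conjI ballI allI)
  show "0 \<in> f ` S"
    using assms bounded_clinear_zero complex_vector.subspace_0 by (metis imageI)
  show "x + y \<in> f ` S" if "x \<in> f ` S" "y \<in> f ` S" for x y
    using that assms complex_vector.subspace_add bounded_clinear_add[OF assms(1)]
    by (metis (no_types, lifting) imageE imageI)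
  show "c *\<^sub>C x \<in> f ` S" if "x \<in> f ` S" for c x
    using that assms complex_vector.subspace_scale bounded_clinear_scaleC[OF assms(1)]
    by (metis (no_types, lifting) imageE imageI)
qed

lemma subspace_vimage_kernel:
  assumes "bounded_clinear f" "complex_vector.subspace S"
  shows "complex_vector.subspace {x \<in> S. f x = 0}"
  using assms(2) unfolding complex_vector.subspace_def
  by (auto simp: bounded_clinear_add[OF assms(1)] bounded_clinear_scaleC[OF assms(1)]
      bounded_clinear_zero[OF assms(1)])

lemma span_image_subset:
  assumes "bounded_clinear f"
  shows "f ` complex_vector.span S \<subseteq> complex_vector.span (f ` S)"
proof -
  have "complex_vector.subspace {x. f x \<in> complex_vector.span (f ` S)}"
    by (simp add: complex_vector.subspace_def bounded_clinear_add[OF assms]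
        bounded_clinear_scaleC[OF assms] bounded_clinear_zero[OF assms]
        complex_vector.span_add complex_vector.span_scale complex_vector.span_zero)
  then have "complex_vector.span S \<subseteq> {x. f x \<in> complex_vector.span (f ` S)}"
    by (intro complex_vector.span_minimal) (auto intro: complex_vector.span_base)
  then show ?thesis by blast
qed

lemma span_image_superset:
  assumes "bounded_clinear f"
  shows "complex_vector.span (f ` S) \<subseteq> f ` complex_vector.span S"
  by (intro complex_vector.span_minimal subspace_image assms)
     (auto intro: complex_vector.span_base)

text \<open>
  If the kernel were spanned by finitely many vectors, adding a single vector on which the functional does
  not vanish would span \<open>W\<close>.
\<close>

lemma infinite_dimensional_kernel:
  assumes W: "complex_vector.subspace W" "\<not> finite_dimensional W"
    and f: "bounded_clinear (f :: _ \<Rightarrow> complex)"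
  shows "\<not> finite_dimensional {x \<in> W. f x = 0}"
proof
  assume "finite_dimensional {x \<in> W. f x = 0}"
  then obtain B where B: "finite B" "{x \<in> W. f x = 0} \<subseteq> complex_vector.span B"
    by (auto simp: finite_dimensional_def)
  show False
  proof (cases "\<forall>w\<in>W. f w = 0")
    case True
    then have "W \<subseteq> complex_vector.span B" using B(2) by blast
    then show False using W B(1) by (auto simp: finite_dimensional_def)
  next
    case False
    then obtain w where w: "w \<in> W" "f w \<noteq> 0" by blast
    have "x \<in> complex_vector.span (insert w B)" if x: "x \<in> W" for x
    proof -
      have "x - (f x / f w) *\<^sub>C w \<in> {x \<in> W. f x = 0}"
        using w x W(1)
        by (simp add: complex_vector.subspace_diff complex_vector.subspace_scale
            bounded_clinear_diff[OF f] bounded_clinear_scaleC[OF f] scaleC_complex_def)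
      with B(2) show ?thesis
        by (auto simp: complex_vector.span_insert)
    qed
    then have "W \<subseteq> complex_vector.span (insert w B)" by blast
    then show False using W(2) B(1) unfolding finite_dimensional_def by blast
  qed
qed

text \<open>
  Orthogonality to finitely many vectors cuts an infinite-dimensional space down by finitely many
  functionals only.
\<close>

lemma infinite_dimensional_orthogonal:
  assumes "complex_vector.subspace W" "\<not> finite_dimensional W" "finite B"
  shows "\<exists>x\<in>W. x \<noteq> 0 \<and> (\<forall>b\<in>complex_vector.span B. cinner b x = 0)"
proof -
  have "\<exists>U\<subseteq>W. complex_vector.subspace U \<and> \<not> finite_dimensional U \<and> (\<forall>x\<in>U. \<forall>b\<in>B. cinner x b = 0)"
    using assms(3)
  proof induction
    case empty
    show ?case using assms by blast
  next
    case (insert b B)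
    then obtain U where U: "U \<subseteq> W" "complex_vector.subspace U" "\<not> finite_dimensional U"
      "\<forall>x\<in>U. \<forall>b\<in>B. cinner x b = 0" by blast
    have f: "bounded_clinear (\<lambda>x. cinner x b)" by (rule bounded_clinear_cinner_left)
    show ?case
      using U infinite_dimensional_kernel[OF U(2,3) f] subspace_vimage_kernel[OF f U(2)]
      by (intro exI[of _ "{x \<in> U. cinner x b = 0}"]) auto
  qed
  then obtain U where U: "U \<subseteq> W" "\<not> finite_dimensional U" "\<forall>x\<in>U. \<forall>b\<in>B. cinner x b = 0" by blast
  have "\<not> U \<subseteq> {0}"
    using U(2) by (auto simp: finite_dimensional_def dest!: spec[of _ "{}"])
  then obtain x where x: "x \<in> U" "x \<noteq> 0" by blast
  have "complex_vector.span B \<subseteq> {b. cinner b x = 0}"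
    using U(3) x(1) by (intro complex_vector.span_minimal)
      (auto simp: complex_vector.subspace_def cinner_simps cinner_eq_0_commute[of _ x])
  then show ?thesis using x U(1) by blast
qed

text \<open>
  The kernel of a finite rank map has a finite-dimensional complement in \<open>L\<close>. If \<open>S\<close> vanished on the kernel,
  its range would be the image of that complement.
\<close>

lemma finite_rank_kernel:
  assumes L: "complex_vector.subspace L" and Y: "bounded_clinear Y" and S: "bounded_clinear S"
    and fin: "finite_dimensional (Y ` L)" and inf: "\<not> finite_dimensional (S ` L)"
  shows "\<exists>l\<in>L. Y l = 0 \<and> S l \<noteq> 0"
proof (rule ccontr)
  assume *: "\<not> ?thesis"
  obtain B where B: "finite B" "Y ` L \<subseteq> complex_vector.span B"
    using fin by (auto simp: finite_dimensional_def)
  obtain B' where B': "B' \<subseteq> Y ` L" "complex_vector.independent B'" "Y ` L \<subseteq> complex_vector.span B'"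
    using complex_vector.maximal_independent_subset by blast
  have "finite B'"
    using complex_vector.independent_span_bound[OF B(1) B'(2)] B'(1) B(2) by blast
  then obtain C where C: "C \<subseteq> L" "finite C" "B' = Y ` C"
    using finite_subset_image[OF _ B'(1)] by blast
  have spanC: "complex_vector.span C \<subseteq> L"
    using C(1) L by (rule complex_vector.span_minimal)
  have "S l \<in> complex_vector.span (S ` C)" if l: "l \<in> L" for l
  proof -
    have "Y l \<in> Y ` complex_vector.span C"
      using l B'(3) C(3) span_image_superset[OF Y, of C] by blast
    then obtain c where c: "c \<in> complex_vector.span C" "Y l = Y c" by blast
    then have "l - c \<in> L" "Y (l - c) = 0"
      using l spanC L by (auto simp: bounded_clinear_diff[OF Y] intro: complex_vector.subspace_diff)
    then have "S l = S c" using * bounded_clinear_diff[OF S, of l c] by auto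
    then show ?thesis using c(1) span_image_subset[OF S, of C] by auto
  qed
  then have "S ` L \<subseteq> complex_vector.span (S ` C)" by blast
  then show False using inf C(2) unfolding finite_dimensional_def by blast
qed

section \<open>Cyclic intertwiners of nilpotent operators\<close>

text \<open>
  This is the operator \<open>\<Sum>\<^sub>j N\<^sup>j v \<otimes> M*\<^sup>m\<^sup>-\<^sup>1\<^sup>-\<^sup>j u\<close> of finite rank. It factors through one nilpotent Jordan block of size
  \<open>m\<close>: the vector \<open>u\<close> gives a map from \<open>M\<close> to the block, and \<open>v\<close> a map from the block to \<open>N\<close>.
\<close>

definition cyclic_map :: "nat \<Rightarrow> ('a::complex_inner \<Rightarrow> 'a) \<Rightarrow> ('b::complex_inner \<Rightarrow> 'b) \<Rightarrow> 'a \<Rightarrow> 'b \<Rightarrow> 'b \<Rightarrow> 'a"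
  where "cyclic_map m N M v u l = (\<Sum>j<m. cinner ((M ^^ (m - Suc j)) l) u *\<^sub>C (N ^^ j) v)"

lemma bounded_clinear_cyclic_map:
  assumes "bounded_clinear M"
  shows "bounded_clinear (cyclic_map m N M v u)"
proof -
  have "bounded_clinear (\<lambda>l. \<Sum>j<m. cinner ((M ^^ (m - Suc j)) l) u *\<^sub>C (N ^^ j) v)"
    by (intro bounded_clinear_sum_fun bounded_clinear_compose[OF bounded_clinear_rank_one]
        bounded_clinear_funpow assms)
  then show ?thesis by (simp add: cyclic_map_def[abs_def])
qed

lemma funpow_in: "N ` K \<subseteq> K \<Longrightarrow> x \<in> K \<Longrightarrow> (N ^^ k) x \<in> K"
  by (induction k) auto

lemma cyclic_map_in:
  assumes "complex_vector.subspace K" "N ` K \<subseteq> K" "v \<in> K"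
  shows "cyclic_map m N M v u l \<in> K"
  unfolding cyclic_map_def
  by (intro complex_vector.subspace_sum complex_vector.subspace_scale funpow_in assms)

lemma finite_dimensional_cyclic_map: "finite_dimensional (cyclic_map m N M v u ` L)"
  unfolding finite_dimensional_def cyclic_map_def
  by (rule exI[of _ "(\<lambda>j. (N ^^ j) v) ` {..<m}"])
     (auto intro!: complex_vector.span_sum complex_vector.span_scale intro: complex_vector.span_base)

text \<open>
  Applying \<open>M\<close> before or \<open>N\<close> after shifts the index of summation by one; the two boundary terms vanish
  by nilpotency.
\<close>

lemma cyclic_map_intertwines:
  assumes N: "bounded_clinear N" and "(M ^^ m) l = 0" "(N ^^ m) v = 0"
    and M: "bounded_clinear M"
  shows "cyclic_map m N M v u (M l) = N (cyclic_map m N M v u l)"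
proof -
  define a where "a j = cinner ((M ^^ (m - j)) l) u *\<^sub>C (N ^^ j) v" for j
  have "cyclic_map m N M v u (M l) = (\<Sum>j<m. a j)"
    unfolding cyclic_map_def a_def
  proof (rule sum.cong[OF refl])
    fix j assume "j \<in> {..<m}"
    then have "m - j = Suc (m - Suc j)" by auto
    then show "cinner ((M ^^ (m - Suc j)) (M l)) u *\<^sub>C (N ^^ j) v
      = cinner ((M ^^ (m - j)) l) u *\<^sub>C (N ^^ j) v"
      by (simp add: funpow_swap1)
  qed
  moreover have "N (cyclic_map m N M v u l) = (\<Sum>j<m. a (Suc j))"
    by (simp add: cyclic_map_def a_def bounded_clinear_sum[OF N] bounded_clinear_scaleC[OF N])
  moreover have "(\<Sum>j<m. a (Suc j)) - (\<Sum>j<m. a j) = a m - a 0"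
    by (simp only: sum_subtractf[symmetric] sum_lessThan_telescope)
  moreover have "a m = 0" "a 0 = 0" by (simp_all add: a_def assms)
  ultimately show ?thesis by simp
qed

text \<open>
  Vectors \<open>l\<close> and \<open>u\<close> are dual if \<open>\<langle>M\<^sup>j l, u\<rangle>\<close> is \<open>1\<close> for \<open>j = m - 1\<close> and \<open>0\<close> for smaller \<open>j\<close>. Duality isolates
  a single summand of the cyclic map.
\<close>

lemma cyclic_map_at_dual:
  assumes "0 < m" "\<And>j. j < m \<Longrightarrow> cinner ((M ^^ j) l) u = (if Suc j = m then 1 else 0)"
  shows "cyclic_map m N M v u l = v"
proof -
  have "cyclic_map m N M v u l = (\<Sum>j<m. if j = 0 then v else 0)"
    unfolding cyclic_map_def using assms by (intro sum.cong) auto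
  then show ?thesis using assms(1) by simp
qed

lemma cinner_cyclic_map_dual:
  assumes "0 < m" "\<And>j. j < m \<Longrightarrow> cinner ((N ^^ j) v) z = (if Suc j = m then 1 else 0)"
  shows "cinner (cyclic_map m N M v u l) z = cinner l u"
proof -
  have "cinner (cyclic_map m N M v u l) z = (\<Sum>j<m. if j = m - 1 then cinner l u else 0)"
    unfolding cyclic_map_def cinner_sum_left using assms
    by (intro sum.cong) (auto simp: cinner_scaleC_left)
  then show ?thesis using assms(1) by simp
qed

lemma cyclic_map_eq_0: "(\<And>j. j < m \<Longrightarrow> cinner ((M ^^ j) l) u = 0) \<Longrightarrow> cyclic_map m N M v u l = 0"
  by (simp add: cyclic_map_def)

text \<open>
  Normalise \<open>v\<^sub>0\<close> so that the value at the top power is \<open>1\<close>. The remaining conditions form a triangular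
  system: subtracting a multiple of \<open>S\<^sup>k\<^sup>+\<^sup>1 v\<close> corrects the value in degree \<open>p - k - 1\<close> without disturbing the
  higher ones.
\<close>

lemma dual_vector_exists:
  assumes K: "complex_vector.subspace K" "S ` K \<subseteq> K" and S: "bounded_clinear S"
    and nil: "\<And>x. x \<in> K \<Longrightarrow> (S ^^ Suc p) x = 0"
    and \<phi>: "bounded_clinear (\<phi> :: _ \<Rightarrow> complex)" and v0: "v0 \<in> K" "\<phi> ((S ^^ p) v0) \<noteq> 0"
  shows "\<exists>v\<in>K. \<forall>j<Suc p. \<phi> ((S ^^ j) v) = (if j = p then 1 else 0)"
proof -
  have nil': "(S ^^ (i + Suc p)) x = 0" if "x \<in> K" for i x
    using nil[OF that] bounded_clinear_zero[OF bounded_clinear_funpow[OF S]] by (simp only: funpow_add comp_apply)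
  have "\<exists>v\<in>K. \<forall>j\<le>p. p - k \<le> j \<longrightarrow> \<phi> ((S ^^ j) v) = (if j = p then 1 else 0)" if "k \<le> p" for k
    using that
  proof (induction k)
    case 0
    define v where "v = (1 / \<phi> ((S ^^ p) v0)) *\<^sub>C v0"
    have "\<phi> ((S ^^ p) v) = 1"
      using v0 by (simp add: v_def bounded_clinear_scaleC[OF bounded_clinear_funpow[OF S]]
          bounded_clinear_scaleC[OF \<phi>] scaleC_complex_def)
    moreover have "v \<in> K" using v0 K by (simp add: v_def complex_vector.subspace_scale)
    ultimately show ?case by auto
  next
    case (Suc k)
    then obtain v where v: "v \<in> K" "\<And>j. j \<le> p \<Longrightarrow> p - k \<le> j \<Longrightarrow> \<phi> ((S ^^ j) v) = (if j = p then 1 else 0)"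
      by auto
    define d where "d = p - Suc k"
    have d: "d + Suc k = p" using Suc.prems by (simp add: d_def)
    define w where "w = v - \<phi> ((S ^^ d) v) *\<^sub>C (S ^^ Suc k) v"
    have "w \<in> K"
      unfolding w_def using v K
      by (intro complex_vector.subspace_diff complex_vector.subspace_scale funpow_in) auto
    moreover have "\<phi> ((S ^^ j) w) = (if j = p then 1 else 0)" if j: "j \<le> p" "p - Suc k \<le> j" for j
    proof -
      have w: "\<phi> ((S ^^ j) w) = \<phi> ((S ^^ j) v) - \<phi> ((S ^^ d) v) * \<phi> ((S ^^ (j + Suc k)) v)"
        unfolding w_def bounded_clinear_diff[OF bounded_clinear_funpow[OF S]]
          bounded_clinear_scaleC[OF bounded_clinear_funpow[OF S]] bounded_clinear_diff[OF \<phi>]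
          bounded_clinear_scaleC[OF \<phi>] scaleC_complex_def funpow_add comp_apply ..
      show ?thesis
      proof (cases "j = d")
        case True
        have "\<phi> ((S ^^ (j + Suc k)) v) = 1"
          using v(2)[of p] True by (simp only: d) simp
        then show ?thesis using w True d by simp
      next
        case False
        then have j': "p - k \<le> j" using j d by (simp add: d_def)
        then have "j + Suc k = (j + k - p) + Suc p" using d by simp
        then have "(S ^^ (j + Suc k)) v = 0" using nil'[OF v(1)] by metis
        then show ?thesis using w v(2)[OF j(1) j'] by (simp add: bounded_clinear_zero[OF \<phi>])
      qed
    qed
    ultimately show ?case by blast
  qed
  from this[of p] show ?thesis by (auto simp: less_Suc_eq_le)
qed

section \<open>Generic intertwiners\<close>

text \<open>
  The perturbations \<open>y + t e\<close> with small \<open>t\<close> show that each open set is dense in the complete space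
  \<open>closure D\<close>, so the category theorem applies. It is enough to perturb the elements of \<open>D\<close> itself, which
  may be much nicer than those of its closure.
\<close>

lemma Baire_generic_element:
  fixes D :: "'v::banach set" and \<U> :: "'v set set"
  assumes ne: "D \<noteq> {}" and cnt: "countable \<U>" and op: "\<And>U. U \<in> \<U> \<Longrightarrow> open U"
    and pert: "\<And>U y. U \<in> \<U> \<Longrightarrow> y \<in> D \<Longrightarrow> \<exists>e. \<forall>t>0. y + t *\<^sub>R e \<in> D \<inter> U"
  shows "\<exists>y \<in> closure D. \<forall>U\<in>\<U>. y \<in> U"
proof -
  define X where "X = subtopology euclidean (closure D)"
  have top: "topspace X = closure D" by (simp add: X_def)
  have dense: "openin X (closure D \<inter> U) \<and> X closure_of (closure D \<inter> U) = topspace X"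
    if U: "U \<in> \<U>" for U
  proof
    show "openin X (closure D \<inter> U)"
      using op[OF U] by (auto simp: X_def openin_subtopology intro!: exI[of _ U])
    have "D \<subseteq> closure (D \<inter> U)"
    proof
      fix y assume "y \<in> D"
      then obtain e where e: "\<forall>t>0. y + t *\<^sub>R e \<in> D \<inter> U" using pert[OF U] by blast
      have "(\<lambda>n. y + inverse (real (Suc n)) *\<^sub>R e) \<longlonglongrightarrow> y + 0 *\<^sub>R e"
        by (intro tendsto_intros LIMSEQ_inverse_real_of_nat)
      moreover have "y + inverse (real (Suc n)) *\<^sub>R e \<in> D \<inter> U" for n
        using e by (simp del: of_nat_Suc)
      ultimately show "y \<in> closure (D \<inter> U)"
        unfolding closure_sequential by (intro exI[of _ "\<lambda>n. y + inverse (real (Suc n)) *\<^sub>R e"]) simp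
    qed
    then have "closure D \<subseteq> closure (closure D \<inter> U)"
      using closure_minimal[OF _ closed_closure] closure_mono[of "D \<inter> U" "closure D \<inter> U"]
        closure_subset[of D] by blast
    then show "X closure_of (closure D \<inter> U) = topspace X"
      unfolding top by (auto simp: X_def closure_of_subtopology)
  qed
  have "completely_metrizable_space X"
    unfolding X_def
    by (intro completely_metrizable_space_closedin completely_metrizable_space_euclidean) auto
  then have "X closure_of \<Inter>((\<lambda>U. closure D \<inter> U) ` \<U>) = topspace X"
    using dense cnt by (intro Baire_category) auto
  then have "\<Inter>((\<lambda>U. closure D \<inter> U) ` \<U>) \<noteq> {} \<or> closure D = {}"
    using top by (metis closure_of_empty)
  moreover have "closure D \<noteq> {}" using ne by simp
  ultimately obtain y where y: "\<And>U. U \<in> \<U> \<Longrightarrow> y \<in> closure D \<inter> U" by blast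
  show ?thesis
  proof (cases "\<U> = {}")
    case True then show ?thesis using \<open>closure D \<noteq> {}\<close> by auto
  next
    case False then show ?thesis using y by blast
  qed
qed

text \<open>
  The first family of conditions says that the range comes close to the projections
  of a dense set; the second says the same of the adjoint of \<open>Y\<close>, whose dense range amounts to
  injectivity of \<open>Y\<close>.
\<close>

lemma quasi_affinity_from_dense_tests:
  fixes Y :: "'b::complex_hilbert \<Rightarrow> 'a::complex_hilbert"
  assumes Y: "bounded_clinear Y" "Y ` L \<subseteq> K" and K: "closed_csubspace K" and L: "closed_csubspace L"
    and C: "closure C = UNIV" and C': "closure C' = UNIV"
    and range: "\<And>c n. c \<in> C \<Longrightarrow> \<exists>l\<in>L. norm (Y l - orth_proj K c) < inverse (real (Suc n))"
    and inj: "\<And>c n. c \<in> C' \<Longrightarrow> \<exists>z. \<forall>l\<in>L. cmod (cinner (Y l) z - cinner l (orth_proj L c)) \<le> inverse (real (Suc n)) * norm l"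
  shows "quasi_affinity L K Y"
  unfolding quasi_affinity_def
proof (intro conjI)
  show "bounded_operator L K Y"
    using Y by (auto simp: bounded_operator_def)
  have "l = 0" if l: "l \<in> L" "Y l = 0" for l
  proof -
    have "cinner c l = 0" if c: "c \<in> C'" for c
    proof -
      have "cmod (cinner l c) \<le> inverse (real (Suc n)) * norm l" for n
      proof -
        have "cinner l (orth_proj L c) = cinner l c"
          using cinner_orth_proj[OF L l(1), of c] by (metis cinner_commute)
        then show ?thesis using inj[OF c, of n] l by fastforce
      qed
      moreover have "(\<lambda>n. inverse (real (Suc n)) * norm l) \<longlonglongrightarrow> 0 * norm l"
        by (intro tendsto_intros LIMSEQ_inverse_real_of_nat)
      ultimately have "cmod (cinner l c) \<le> 0 * norm l"
        by (intro LIMSEQ_le_const[of "\<lambda>n. inverse (real (Suc n)) * norm l"]) auto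
      then show ?thesis by (simp add: cinner_eq_0_commute)
    qed
    then have "cinner l l = 0"
      using C' by (intro closure_orthogonal[of l C']) auto
    then show ?thesis by simp
  qed
  then show "inj_on Y L"
    by (intro inj_onI) (metis L Y(1) bounded_clinear_diff closed_csubspace_diff eq_iff_diff_eq_0)
  show "K \<subseteq> closure (Y ` L)"
  proof
    fix x assume x: "x \<in> K"
    show "x \<in> closure (Y ` L)"
      unfolding closure_approachable
    proof (intro allI impI)
      fix e :: real assume "0 < e"
      then have e2: "0 < e / 2" by simp
      have "x \<in> closure C" using C by simp
      then obtain c where c: "c \<in> C" "dist c x < e / 2"
        using e2 unfolding closure_approachable by blast
      obtain n where n: "inverse (real (Suc n)) < e / 2"
        using reals_Archimedean[OF e2] by blast
      obtain l where l: "l \<in> L" "norm (Y l - orth_proj K c) < inverse (real (Suc n))"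
        using range[OF c(1)] by blast
      have "norm (orth_proj K c - x) \<le> norm (c - x)"
        using norm_orth_proj_le[OF K, of "c - x"]
        by (simp add: bounded_clinear_diff[OF bounded_clinear_orth_proj[OF K]] orth_proj_id[OF K x])
      moreover have "dist (Y l) x \<le> norm (Y l - orth_proj K c) + norm (orth_proj K c - x)"
        using norm_triangle_ineq[of "Y l - orth_proj K c" "orth_proj K c - x"]
        by (simp add: dist_norm)
      ultimately show "\<exists>y\<in>Y ` L. dist y x < e"
        using l c(2) n by (intro bexI[of _ "Y l"]) (auto simp: dist_norm)
    qed
  qed
qed

text \<open>
  If \<open>N\<close> and \<open>M\<close> have the same order of nilpotency and both top powers have infinite rank, a generic
  intertwiner in the closure of the finite rank intertwiners is a quasi-affinity. An
  intertwiner \<open>Y\<close> of finite rank leaves enough room: there is a vector \<open>l\<close> of top order in its kernel, and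
  adding a cyclic map \<open>t E\<close> with \<open>E l = y\<close> puts \<open>y\<close> into the range of \<open>Y + tE\<close> for every \<open>t > 0\<close>. Dually there is
  a vector \<open>z\<close> of top order orthogonal to the range of \<open>Y\<close>, and a cyclic map whose adjoint sends
  \<open>z\<close> to a prescribed vector puts that vector into the range of the adjoint of \<open>Y + tE\<close>.
\<close>

lemma quasi_affinity_infinite_multiplicity:
  fixes N :: "'a::complex_hilbert \<Rightarrow> 'a" and M :: "'b::complex_hilbert \<Rightarrow> 'b"
  assumes sepa: "\<exists>C::'a set. countable C \<and> closure C = UNIV"
    and sepb: "\<exists>C::'b set. countable C \<and> closure C = UNIV"
    and N: "bounded_clinear N" and M: "bounded_clinear M"
    and K: "closed_csubspace K" "N ` K \<subseteq> K" and L: "closed_csubspace L" "M ` L \<subseteq> L"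
    and nilN: "\<And>x. x \<in> K \<Longrightarrow> (N ^^ Suc p) x = 0" and nilM: "\<And>x. x \<in> L \<Longrightarrow> (M ^^ Suc p) x = 0"
    and infN: "\<not> finite_dimensional ((N ^^ p) ` K)" and infM: "\<not> finite_dimensional ((M ^^ p) ` L)"
  shows "\<exists>Y. bounded_clinear Y \<and> quasi_affinity L K Y \<and> (\<forall>l\<in>L. Y (M l) = N (Y l))"
proof -
  have subK: "complex_vector.subspace K" and subL: "complex_vector.subspace L"
    using K L by (auto simp: closed_csubspace_def)
  obtain C where C: "countable C" "closure C = (UNIV :: 'a set)" using sepa by blast
  obtain C' where C': "countable C'" "closure C' = (UNIV :: 'b set)" using sepb by blast
  define good where "good Y \<longleftrightarrow> bounded_clinear (blinfun_apply Y) \<and>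
      (\<forall>l\<in>L. Y l \<in> K) \<and> (\<forall>l\<in>L. Y (M l) = N (Y l))" for Y :: "'b \<Rightarrow>\<^sub>L 'a"
  define D where "D = {Y. good Y \<and> finite_dimensional (blinfun_apply Y ` L)}"
  define U1 where "U1 c n = {Y::'b \<Rightarrow>\<^sub>L 'a. \<exists>l\<in>L. norm (Y l - orth_proj K c) < inverse (real (Suc n))}" for c n
  \<comment> \<open>The bound is strict, with room d below the threshold, to make the set open.\<close>
  define U2 where "U2 c n = {Y::'b \<Rightarrow>\<^sub>L 'a. \<exists>z. \<exists>d<inverse (real (Suc n)). \<forall>l\<in>L.
      cmod (cinner (Y l) z - cinner l (orth_proj L c)) \<le> d * norm l}" for c n
  define \<U> where "\<U> = (\<lambda>(c, n). U1 c n) ` (C \<times> UNIV) \<union> (\<lambda>(c, n). U2 c n) ` (C' \<times> UNIV)"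

  have cyclic: "\<exists>E. \<forall>Y t. Y \<in> D \<longrightarrow>
      Y + t *\<^sub>R E \<in> D \<and> (\<forall>l. (Y + t *\<^sub>R E) l = Y l + of_real t *\<^sub>C cyclic_map (Suc p) N M v u l)"
    if v: "v \<in> K" for v u
  proof -
    let ?E = "cyclic_map (Suc p) N M v u"
    define E where "E = Blinfun ?E"
    have lin: "bounded_clinear ?E" by (rule bounded_clinear_cyclic_map[OF M])
    have E: "blinfun_apply E = ?E"
      unfolding E_def by (rule bounded_linear_Blinfun_apply[OF bounded_clinear_bounded_linear[OF lin]])
    have "Y + t *\<^sub>R E \<in> D" and "(Y + t *\<^sub>R E) l = Y l + of_real t *\<^sub>C ?E l" if Y: "Y \<in> D" for Y t l
    proof -
      have gY: "bounded_clinear (blinfun_apply Y)" "\<And>l. l \<in> L \<Longrightarrow> Y l \<in> K"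
        "\<And>l. l \<in> L \<Longrightarrow> Y (M l) = N (Y l)" and fY: "finite_dimensional (blinfun_apply Y ` L)"
        using Y by (auto simp: D_def good_def)
      show app: "(Y + t *\<^sub>R E) l = Y l + of_real t *\<^sub>C ?E l" for l
        by (simp add: blinfun.add_left blinfun.scaleR_left E scaleC_of_real)
      then have app': "blinfun_apply (Y + t *\<^sub>R E) = (\<lambda>l. Y l + of_real t *\<^sub>C ?E l)" by blast
      obtain B where B: "finite B" "blinfun_apply Y ` L \<subseteq> complex_vector.span B"
        using fY by (auto simp: finite_dimensional_def)
      obtain B' where B': "finite B'" "?E ` L \<subseteq> complex_vector.span B'"
        using finite_dimensional_cyclic_map[of "Suc p" N M v u L] by (auto simp: finite_dimensional_def)
      have "Y l + of_real t *\<^sub>C ?E l \<in> complex_vector.span (B \<union> B')" if "l \<in> L" for l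
      proof (intro complex_vector.span_add complex_vector.span_scale)
        show "Y l \<in> complex_vector.span (B \<union> B')"
          using that B(2) complex_vector.span_mono[of B "B \<union> B'"] by blast
        show "?E l \<in> complex_vector.span (B \<union> B')"
          using that B'(2) complex_vector.span_mono[of B' "B \<union> B'"] by blast
      qed
      then have "finite_dimensional (blinfun_apply (Y + t *\<^sub>R E) ` L)"
        unfolding finite_dimensional_def app' using B(1) B'(1) by (intro exI[of _ "B \<union> B'"]) auto
      moreover have "good (Y + t *\<^sub>R E)"
        unfolding good_def app'
      proof (intro conjI ballI)
        show "bounded_clinear (\<lambda>l. Y l + of_real t *\<^sub>C ?E l)"
          by (intro bounded_clinear_plus bounded_clinear_scaled gY lin)
        show "Y l + of_real t *\<^sub>C ?E l \<in> K" if "l \<in> L" for l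
          by (intro complex_vector.subspace_add complex_vector.subspace_scale subK gY that
              cyclic_map_in K v)
        show "Y (M l) + of_real t *\<^sub>C ?E (M l) = N (Y l + of_real t *\<^sub>C ?E l)" if "l \<in> L" for l
          using that cyclic_map_intertwines[OF N nilM nilN M, of l v u] v
          by (simp add: gY bounded_clinear_add[OF N] bounded_clinear_scaleC[OF N])
      qed
      ultimately show "Y + t *\<^sub>R E \<in> D" by (simp add: D_def)
    qed
    then show ?thesis by blast
  qed

  have "\<exists>Y\<in>closure D. \<forall>U\<in>\<U>. Y \<in> U"
  proof (rule Baire_generic_element)
    have "good 0"
      using closed_csubspace_0[OF K(1)] by (simp add: good_def bounded_clinear_iff bounded_clinear_zero[OF N] blinfun.bounded_linear_right)
    moreover have "finite_dimensional (blinfun_apply (0 :: 'b \<Rightarrow>\<^sub>L 'a) ` L)"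
      unfolding finite_dimensional_def by (intro exI[of _ "{}"]) auto
    ultimately show "D \<noteq> {}" by (auto simp: D_def)
    show "countable \<U>" unfolding \<U>_def using C C' by auto
    show "open U" if "U \<in> \<U>" for U
    proof -
      have "open (U1 c n)" for c n
      proof -
        have "U1 c n = (\<Union>l\<in>L. {Y. norm (blinfun_apply Y l - orth_proj K c) < inverse (real (Suc n))})"
          by (auto simp: U1_def)
        also have "open \<dots>"
          by (intro open_UN ballI open_Collect_less continuous_intros)
        finally show ?thesis .
      qed
      moreover have "open (U2 c n)" for c n
      proof (rule openI)
        fix Y assume "Y \<in> U2 c n"
        then obtain z d where d: "d < inverse (real (Suc n))"
          and zd: "\<And>l. l \<in> L \<Longrightarrow> cmod (cinner (Y l) z - cinner l (orth_proj L c)) \<le> d * norm l"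
          unfolding U2_def by blast
        define e where "e = (inverse (real (Suc n)) - d) / (norm z + 1)"
        have z1: "0 < norm z + 1" by (simp add: add_nonneg_pos)
        have e: "0 < e" "d + e * norm z < inverse (real (Suc n))"
        proof -
          show "0 < e" using d z1 by (simp add: e_def)
          moreover have "e * (norm z + 1) = inverse (real (Suc n)) - d"
            using z1 by (simp add: e_def)
          ultimately show "d + e * norm z < inverse (real (Suc n))" by (simp add: distrib_left)
        qed
        have "Y' \<in> U2 c n" if Y': "Y' \<in> ball Y e" for Y'
        proof -
          have "cmod (cinner (Y' l) z - cinner l (orth_proj L c)) \<le> (d + e * norm z) * norm l"
            if l: "l \<in> L" for l
          proof -
            have "cmod (cinner ((Y' - Y) l) z) \<le> norm ((Y' - Y) l) * norm z"
              by (rule cinner_Cauchy_Schwarz)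
            also have "\<dots> \<le> (norm (Y' - Y) * norm l) * norm z"
              by (intro mult_right_mono norm_blinfun) simp
            also have "\<dots> \<le> (e * norm l) * norm z"
              using Y' by (intro mult_right_mono) (auto simp: dist_norm norm_minus_commute)
            finally have "cmod (cinner ((Y' - Y) l) z) \<le> e * norm z * norm l"
              by (simp add: mult_ac)
            moreover have split: "cinner (Y' l) z - cinner l (orth_proj L c)
              = cinner ((Y' - Y) l) z + (cinner (Y l) z - cinner l (orth_proj L c))"
              by (simp add: blinfun.diff_left cinner_diff_left)
            ultimately show ?thesis
              using zd[OF l] norm_triangle_ineq[of "cinner ((Y' - Y) l) z" "cinner (Y l) z - cinner l (orth_proj L c)"]
              unfolding distrib_right split by linarith
          qed
          then show ?thesis using e(2) unfolding U2_def by blast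
        qed
        then show "\<exists>e>0. ball Y e \<subseteq> U2 c n" using e(1) by blast
      qed
      ultimately show ?thesis using that by (auto simp: \<U>_def)
    qed
    fix U Y assume U: "U \<in> \<U>" and Y: "Y \<in> D"
    then have gY: "bounded_clinear (blinfun_apply Y)" "\<And>l. l \<in> L \<Longrightarrow> Y l \<in> K"
      "\<And>l. l \<in> L \<Longrightarrow> Y (M l) = N (Y l)" and fY: "finite_dimensional (blinfun_apply Y ` L)"
      by (auto simp: D_def good_def)
    consider c n where "c \<in> C" "U = U1 c n" | c n where "c \<in> C'" "U = U2 c n"
      using U by (auto simp: \<U>_def)
    then show "\<exists>e. \<forall>t>0. Y + t *\<^sub>R e \<in> D \<inter> U"
    proof cases
      case 1
      define y where "y = orth_proj K c"
      have y: "y \<in> K" unfolding y_def by (rule orth_proj_in[OF K(1)])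
      obtain l0 where l0: "l0 \<in> L" "Y l0 = 0" "(M ^^ p) l0 \<noteq> 0"
        using finite_rank_kernel[OF subL gY(1) bounded_clinear_funpow[OF M] fY infM] by blast
      \<comment> \<open>The kernel of Y is invariant under M, so a vector dual to u can be found inside it.\<close>
      define u where "u = (M ^^ p) l0"
      let ?L0 = "{l \<in> L. Y l = 0}"
      have "\<exists>l\<in>?L0. \<forall>j<Suc p. cinner ((M ^^ j) l) u = (if j = p then 1 else 0)"
      proof (rule dual_vector_exists)
        show "complex_vector.subspace ?L0" by (rule subspace_vimage_kernel[OF gY(1) subL])
        show "M ` ?L0 \<subseteq> ?L0" using L(2) gY(3) bounded_clinear_zero[OF N] by auto
        show "bounded_clinear (\<lambda>x. cinner x u)" by (rule bounded_clinear_cinner_left)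
        show "(M ^^ Suc p) x = 0" if "x \<in> ?L0" for x using that nilM by blast
        show "l0 \<in> ?L0" using l0 by blast
        show "cinner ((M ^^ p) l0) u \<noteq> 0" using l0(3) by (simp add: u_def)
      qed (rule M)
      then obtain l where l: "l \<in> L" "Y l = 0"
        and dual: "\<And>j. j < Suc p \<Longrightarrow> cinner ((M ^^ j) l) u = (if j = p then 1 else 0)" by blast
      obtain E where E: "\<And>Y t. Y \<in> D \<Longrightarrow> Y + t *\<^sub>R E \<in> D"
        "\<And>Y t l. Y \<in> D \<Longrightarrow> (Y + t *\<^sub>R E) l = Y l + of_real t *\<^sub>C cyclic_map (Suc p) N M y u l"
        using cyclic[OF y, of u] by blast
      have El: "cyclic_map (Suc p) N M y u l = y"
        by (rule cyclic_map_at_dual) (use dual in auto)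
      have "Y + t *\<^sub>R E \<in> U1 c n" if t: "0 < t" for t
      proof -
        \<comment> \<open>Y vanishes at l, so only the cyclic map contributes, and y is attained exactly.\<close>
        have "(Y + t *\<^sub>R E) ((1 / of_real t) *\<^sub>C l) = y"
          using t by (simp only: E(2)[OF Y] bounded_clinear_scaleC[OF gY(1)] l(2)
              bounded_clinear_scaleC[OF bounded_clinear_cyclic_map[OF M]] El) (simp add: scaleC_scaleC)
        moreover have "(1 / of_real t) *\<^sub>C l \<in> L" using l(1) L(1) by (simp add: closed_csubspace_scaleC)
        ultimately show ?thesis unfolding U1_def y_def
          by (intro CollectI bexI[of _ "(1 / of_real t) *\<^sub>C l"]) simp_all
      qed
      then show ?thesis using E(1)[OF Y] 1 by blast
    next
      case 2
      define w where "w = orth_proj L c"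
      obtain B where B: "finite B" "blinfun_apply Y ` L \<subseteq> complex_vector.span B"
        using fY by (auto simp: finite_dimensional_def)
      \<comment> \<open>The vector z lies in the range of the top power of N, so that it has a dual vector in K.\<close>
      obtain z where z: "z \<in> (N ^^ p) ` K" "z \<noteq> 0" "\<And>b. b \<in> complex_vector.span B \<Longrightarrow> cinner b z = 0"
        using infinite_dimensional_orthogonal[OF subspace_image[OF bounded_clinear_funpow[OF N] subK] infN B(1)]
        by blast
      then obtain v0 where v0: "v0 \<in> K" "z = (N ^^ p) v0" by blast
      have "\<exists>v\<in>K. \<forall>j<Suc p. cinner ((N ^^ j) v) z = (if j = p then 1 else 0)"
      proof (rule dual_vector_exists)
        show "bounded_clinear (\<lambda>x. cinner x z)" by (rule bounded_clinear_cinner_left)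
        show "cinner ((N ^^ p) v0) z \<noteq> 0" using v0 z(2) by simp
      qed (use subK K(2) N nilN v0 in auto)
      then obtain v where v: "v \<in> K"
        and dual: "\<And>j. j < Suc p \<Longrightarrow> cinner ((N ^^ j) v) z = (if j = p then 1 else 0)" by blast
      obtain E where E: "\<And>Y t. Y \<in> D \<Longrightarrow> Y + t *\<^sub>R E \<in> D"
        "\<And>Y t l. Y \<in> D \<Longrightarrow> (Y + t *\<^sub>R E) l = Y l + of_real t *\<^sub>C cyclic_map (Suc p) N M v w l"
        using cyclic[OF v, of w] by blast
      have El: "cinner (cyclic_map (Suc p) N M v w l) z = cinner l w" for l
        by (rule cinner_cyclic_map_dual) (use dual in auto)
      have "Y + t *\<^sub>R E \<in> U2 c n" if t: "0 < t" for t
      proof -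
        have "cmod (cinner ((Y + t *\<^sub>R E) l) ((1 / of_real t) *\<^sub>C z) - cinner l (orth_proj L c)) \<le> 0 * norm l"
          if l: "l \<in> L" for l
        proof -
          have "cinner (Y l) z = 0" using l B(2) z(3) by blast
          then have "cinner ((Y + t *\<^sub>R E) l) ((1 / of_real t) *\<^sub>C z) = cinner l w"
            using t by (simp only: E(2)[OF Y]) (simp add: cinner_simps El)
          then show ?thesis by (simp add: w_def)
        qed
        moreover have "0 < inverse (real (Suc n))" by simp
        ultimately show ?thesis unfolding U2_def by blast
      qed
      then show ?thesis using E(1)[OF Y] 2 by blast
    qed
  qed
  then obtain Y where Y: "Y \<in> closure D" "\<And>U. U \<in> \<U> \<Longrightarrow> Y \<in> U" by blast
  obtain F where F: "\<And>n. F n \<in> D" "F \<longlonglongrightarrow> Y"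
    using Y(1) unfolding closure_sequential by blast
  have lim: "(\<lambda>n. F n l) \<longlonglongrightarrow> Y l" for l
    by (intro tendsto_intros F)
  have gF: "bounded_clinear (blinfun_apply (F n))" "\<And>l. l \<in> L \<Longrightarrow> F n l \<in> K"
    "\<And>l. l \<in> L \<Longrightarrow> F n (M l) = N (F n l)" for n
    using F(1)[of n] by (auto simp: D_def good_def)
  have Ylin: "bounded_clinear (blinfun_apply Y)"
    unfolding bounded_clinear_iff
  proof (intro conjI allI blinfun.bounded_linear_right)
    fix c l
    have "(\<lambda>n. F n (c *\<^sub>C l)) \<longlonglongrightarrow> c *\<^sub>C Y l"
      unfolding bounded_clinear_scaleC[OF gF(1)]
      by (rule bounded_clinear_tendsto[OF bounded_clinear_scaled[OF bounded_clinear_ident] lim])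
    then show "Y (c *\<^sub>C l) = c *\<^sub>C Y l" using lim LIMSEQ_unique by blast
  qed
  have YK: "Y l \<in> K" if "l \<in> L" for l
    by (rule closed_sequentially[of K "\<lambda>n. F n l", OF _ gF(2)[OF that] lim])
       (use K(1) in \<open>simp add: closed_csubspace_def\<close>)
  have YN: "Y (M l) = N (Y l)" if "l \<in> L" for l
    using lim[of "M l"] bounded_clinear_tendsto[OF N lim[of l]] LIMSEQ_unique
    unfolding gF(3)[OF that] by blast
  have "quasi_affinity L K (blinfun_apply Y)"
  proof (rule quasi_affinity_from_dense_tests[OF Ylin _ K(1) L(1) C(2) C'(2)])
    show "\<exists>l\<in>L. norm (Y l - orth_proj K c) < inverse (real (Suc n))" if "c \<in> C" for c n
      using Y(2)[of "U1 c n"] that by (auto simp: \<U>_def U1_def)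
    show "\<exists>z. \<forall>l\<in>L. cmod (cinner (Y l) z - cinner l (orth_proj L c)) \<le> inverse (real (Suc n)) * norm l"
      if "c \<in> C'" for c n
    proof -
      have "Y \<in> U2 c n" using Y(2)[of "U2 c n"] that by (auto simp: \<U>_def)
      then obtain z d where zd: "d < inverse (real (Suc n))"
        "\<And>l. l \<in> L \<Longrightarrow> cmod (cinner (Y l) z - cinner l (orth_proj L c)) \<le> d * norm l"
        unfolding U2_def by blast
      have "d * norm l \<le> inverse (real (Suc n)) * norm l" for l
        using zd(1) by (intro mult_right_mono) auto
      then show ?thesis using zd(2) by (meson order_trans)
    qed
  qed (use YK in blast)
  then show ?thesis using Ylin YN by blast
qed

section \<open>Reversing quasi-affinities between nilpotent operators\<close>

lemma quasi_affinityD: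
  assumes "quasi_affinity K L X"
  shows "\<And>x. x \<in> K \<Longrightarrow> X x \<in> L" "inj_on X K" "\<And>y. y \<in> L \<Longrightarrow> y \<in> closure (X ` K)"
  using assms by (auto simp: quasi_affinity_def bounded_operator_def)

lemma quasi_affinity_limit:
  assumes "quasi_affinity K L X" "y \<in> L"
  obtains x where "\<And>n. x n \<in> K" "(\<lambda>n. X (x n)) \<longlonglongrightarrow> y"
proof -
  obtain f where f: "\<And>n. f n \<in> X ` K" "f \<longlonglongrightarrow> y"
    using quasi_affinityD(3)[OF assms] unfolding closure_sequential by blast
  have "\<exists>x. x \<in> K \<and> f n = X x" for n
    using f(1)[of n] by blast
  then obtain x where "\<And>n. x n \<in> K \<and> f n = X (x n)"
    by metis
  then have x: "\<And>n. x n \<in> K \<and> X (x n) = f n" by simp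
  then have "(\<lambda>n. X (x n)) = f" by blast
  then show thesis using that[of x] x f(2) by simp
qed

lemma quasi_affinityI:
  assumes X: "bounded_clinear X" and K: "closed_csubspace K" and "\<And>x. x \<in> K \<Longrightarrow> X x \<in> L"
    and "\<And>x. x \<in> K \<Longrightarrow> X x = 0 \<Longrightarrow> x = 0"
    and "\<And>y. y \<in> L \<Longrightarrow> y \<in> closure (X ` K)"
  shows "quasi_affinity K L X"
  unfolding quasi_affinity_def
proof (intro conjI)
  show "bounded_operator K L X"
    using X assms(3) by (auto simp: bounded_operator_def)
  show "inj_on X K"
    using assms(4) K
    by (intro inj_onI) (metis X bounded_clinear_diff closed_csubspace_diff eq_iff_diff_eq_0)
qed (use assms(5) in blast)

lemma intertwine_funpow:
  assumes "N ` K \<subseteq> K" "\<And>x. x \<in> K \<Longrightarrow> X (N x) = M (X x)" "x \<in> K"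
  shows "X ((N ^^ j) x) = (M ^^ j) (X x)"
  using assms(3) by (induction j arbitrary: x) (use assms funpow_in[OF assms(1)] in auto)

lemma quasi_affinity_eq_0:
  assumes "quasi_affinity K L X" "closed_csubspace K" "bounded_clinear X" "x \<in> K" "X x = 0"
  shows "x = 0"
  using quasi_affinityD(2)[OF assms(1)] assms closed_csubspace_0[OF assms(2)] bounded_clinear_zero[OF assms(3)]
  by (metis inj_onD)

lemma nilpotent_pullback:
  assumes "quasi_affinity K L X" "closed_csubspace K" "bounded_clinear X"
    and "N ` K \<subseteq> K" "\<And>x. x \<in> K \<Longrightarrow> X (N x) = M (X x)" "\<And>y. y \<in> L \<Longrightarrow> (M ^^ m) y = 0" "x \<in> K"
  shows "(N ^^ m) x = 0"
proof (rule quasi_affinity_eq_0[OF assms(1-3)])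
  show "(N ^^ m) x \<in> K" by (rule funpow_in[OF assms(4,7)])
  show "X ((N ^^ m) x) = 0"
    using intertwine_funpow[where X = X and M = M, OF assms(4,5,7)] assms(6)[OF quasi_affinityD(1)[OF assms(1,7)]] by simp
qed

text \<open>
  Splitting off one Jordan block of maximal size. For dual \<open>X k\<close> and \<open>u\<close> the cyclic map \<open>E\<close> is an idempotent
  commuting with \<open>M\<close>: its range is the cyclic space of \<open>X k\<close> and its kernel in \<open>L\<close> is \<open>L'\<close>. The choice of the
  generator in the range of \<open>X\<close> lets \<open>X\<close> transport the splitting to \<open>K\<close>, where the cyclic space of \<open>k\<close> is
  complementary to \<open>K'\<close>. On the cyclic spaces \<open>X\<close> is invertible, with inverse given by the cyclic map \<open>F\<close> of
  \<open>k\<close> and \<open>u\<close>; so a quasi-affinity \<open>Y'\<close> between the complements extends as \<open>F + Y' (I - E)\<close>.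
\<close>

lemma cyclic_splitting:
  fixes N :: "'a::complex_hilbert \<Rightarrow> 'a" and M :: "'b::complex_hilbert \<Rightarrow> 'b"
  assumes N: "bounded_clinear N" and M: "bounded_clinear M" and X: "bounded_clinear X"
    and K: "closed_csubspace K" "N ` K \<subseteq> K" and L: "closed_csubspace L" "M ` L \<subseteq> L"
    and qa: "quasi_affinity K L X" and comm: "\<And>x. x \<in> K \<Longrightarrow> X (N x) = M (X x)"
    and nilM: "\<And>x. x \<in> L \<Longrightarrow> (M ^^ Suc p) x = 0"
    and k: "k \<in> K" "\<And>j. j < Suc p \<Longrightarrow> cinner ((M ^^ j) (X k)) u = (if j = p then 1 else 0)"
    and L': "L' = {l \<in> L. \<forall>j<Suc p. cinner ((M ^^ j) l) u = 0}" and K': "K' = {x \<in> K. X x \<in> L'}"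
  shows "closed_csubspace K'" "N ` K' \<subseteq> K'" "closed_csubspace L'" "M ` L' \<subseteq> L'"
    "quasi_affinity K' L' X" "X k \<in> L" "(M ^^ p) (X k) \<notin> (M ^^ p) ` L'"
    "\<And>Y'. bounded_clinear Y' \<Longrightarrow> quasi_affinity L' K' Y' \<Longrightarrow> (\<And>l. l \<in> L' \<Longrightarrow> Y' (M l) = N (Y' l)) \<Longrightarrow>
      \<exists>Y. bounded_clinear Y \<and> quasi_affinity L K Y \<and> (\<forall>l\<in>L. Y (M l) = N (Y l))"
proof -
  have subK: "complex_vector.subspace K" and subL: "complex_vector.subspace L"
    using K L by (auto simp: closed_csubspace_def)
  have nilN: "(N ^^ Suc p) x = 0" if "x \<in> K" for x
    by (rule nilpotent_pullback[OF qa K(1) X K(2) comm nilM that])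
  show f: "X k \<in> L" by (rule quasi_affinityD(1)[OF qa k(1)])
  define E where "E = cyclic_map (Suc p) M M (X k) u"
  define F where "F = cyclic_map (Suc p) N M k u"
  have Elin: "bounded_clinear E" and Flin: "bounded_clinear F"
    unfolding E_def F_def by (intro bounded_clinear_cyclic_map M)+
  have EL: "E l \<in> L" and FK: "F l \<in> K" for l
    unfolding E_def F_def by (intro cyclic_map_in subK subL K L f k)+
  have XF: "X (F l) = E l" for l
    unfolding E_def F_def cyclic_map_def
    by (simp add: bounded_clinear_sum[OF X] bounded_clinear_scaleC[OF X]
        intertwine_funpow[where X = X and M = M, OF K(2) comm k(1)] del: sum.lessThan_Suc)
  have EM: "E (M l) = M (E l)" if "l \<in> L" for l
    unfolding E_def by (rule cyclic_map_intertwines[OF M nilM[OF that] nilM[OF f] M])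
  have FM: "F (M l) = N (F l)" if "l \<in> L" for l
    unfolding F_def by (rule cyclic_map_intertwines[OF N nilM[OF that] nilN[OF k(1)] M])
  have Eu: "cinner (E l) u = cinner l u" for l
    unfolding E_def by (rule cinner_cyclic_map_dual) (use k(2) in auto)
  have EMj: "E ((M ^^ j) l) = (M ^^ j) (E l)" if "l \<in> L" for j l
    by (rule intertwine_funpow[where X = E and M = M, OF L(2) EM that])
  have L'I: "l - E l \<in> L'" if l: "l \<in> L" for l
  proof -
    have "cinner ((M ^^ j) (l - E l)) u = 0" for j
      using Eu[of "(M ^^ j) l"]
      by (simp add: bounded_clinear_diff[OF bounded_clinear_funpow[OF M]] cinner_diff_left flip: EMj[OF l])
    then show ?thesis
      unfolding L' using closed_csubspace_diff[OF L(1) l EL] by blast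
  qed
  have E0: "E l = 0" and F0: "F l = 0" if "l \<in> L'" for l
    unfolding E_def F_def using that by (auto simp: L' intro!: cyclic_map_eq_0)
  have L'L: "l \<in> L" if "l \<in> L'" for l using that by (simp add: L')
  have L'0: "l \<in> L'" if "l \<in> L" "\<And>j. j < Suc p \<Longrightarrow> cinner ((M ^^ j) l) u = 0" for l
    using that by (simp add: L')
  show cL': "closed_csubspace L'"
  proof -
    have 1: "bounded_clinear (\<lambda>l. cinner ((M ^^ j) l) u)" for j
      by (rule bounded_clinear_compose[OF bounded_clinear_cinner_left bounded_clinear_funpow[OF M]])
    have "complex_vector.subspace L'"
      using subL unfolding complex_vector.subspace_def L'
      by (auto simp: bounded_clinear_add[OF 1] bounded_clinear_scaleC[OF 1] bounded_clinear_zero[OF 1])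
    moreover have "L' = L \<inter> (\<Inter>j<Suc p. {l. cinner ((M ^^ j) l) u = 0})"
      unfolding L' by blast
    moreover have "closed {l. cinner ((M ^^ j) l) u = 0}" for j
      by (rule closed_Collect_eq[OF bounded_clinear_continuous[OF 1] continuous_on_const])
    ultimately show ?thesis
      using L(1) by (auto simp: closed_csubspace_def intro!: closed_Int closed_INT)
  qed
  show M_inv': "M ` L' \<subseteq> L'"
  proof
    fix y assume "y \<in> M ` L'"
    then obtain l where l: "l \<in> L'" "y = M l" by blast
    have "cinner ((M ^^ j) (M l)) u = 0" if "j < Suc p" for j
    proof (cases "j = p")
      case True
      then have "(M ^^ j) (M l) = 0" using nilM[OF L'L[OF l(1)]] by (simp add: funpow_swap1)
      then show ?thesis by simp
    next
      case False
      then have "Suc j < Suc p" using that by simp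
      then have "cinner ((M ^^ Suc j) l) u = 0" using l(1) unfolding L' by blast
      then show ?thesis by (simp add: funpow_swap1)
    qed
    then show "y \<in> L'" using l L(2) L'L by (intro L'0) auto
  qed
  show cK': "closed_csubspace K'"
    using closed_csubspace_Int[OF K(1) closed_csubspace_vimage[OF X cL']] by (simp add: K' Int_def)
  show "N ` K' \<subseteq> K'" using K(2) M_inv' comm by (auto simp: K')
  have K'I: "x - F (X x) \<in> K'" if x: "x \<in> K" for x
    using closed_csubspace_diff[OF K(1) x FK] L'I[OF quasi_affinityD(1)[OF qa x]]
    by (simp add: K' bounded_clinear_diff[OF X] XF)
  have inj: "x = 0" if "x \<in> K" "X x = 0" for x
    by (rule quasi_affinity_eq_0[OF qa K(1) X that])
  show "quasi_affinity K' L' X"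
  proof (rule quasi_affinityI[OF X cK'])
    fix y assume y: "y \<in> L'"
    obtain x where x: "\<And>n. x n \<in> K" "(\<lambda>n. X (x n)) \<longlonglongrightarrow> y"
      by (rule quasi_affinity_limit[OF qa L'L[OF y]]) (rule that)
    have "(\<lambda>n. X (x n) - E (X (x n))) \<longlonglongrightarrow> y - E y"
      by (intro tendsto_diff x bounded_clinear_tendsto[OF Elin])
    then have "(\<lambda>n. X (x n - F (X (x n)))) \<longlonglongrightarrow> y"
      by (simp add: bounded_clinear_diff[OF X] XF E0[OF y])
    moreover have "X (x n - F (X (x n))) \<in> X ` K'" for n
      using K'I[OF x(1)] by blast
    ultimately show "y \<in> closure (X ` K')"
      by (rule closure_limitI[rotated])
  qed (auto simp: K' inj)
  show "(M ^^ p) (X k) \<notin> (M ^^ p) ` L'"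
  proof
    assume "(M ^^ p) (X k) \<in> (M ^^ p) ` L'"
    then obtain l where "l \<in> L'" "(M ^^ p) (X k) = (M ^^ p) l" by blast
    then show False using k(2)[of p] by (auto simp: L')
  qed

  fix Y' assume Y': "bounded_clinear Y'" and qa': "quasi_affinity L' K' Y'"
    and comm': "\<And>l. l \<in> L' \<Longrightarrow> Y' (M l) = N (Y' l)"
  define Y where "Y l = F l + Y' (l - E l)" for l
  have Ylin: "bounded_clinear Y"
    unfolding Y_def[abs_def]
    by (rule bounded_clinear_plus[OF Flin bounded_clinear_compose[OF Y' bounded_clinear_sub[OF bounded_clinear_ident Elin]]])
  have K'K: "x \<in> K" if "x \<in> K'" for x using that by (simp add: K')
  have Y'K: "Y' (l - E l) \<in> K'" if "l \<in> L" for l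
    by (rule quasi_affinityD(1)[OF qa' L'I[OF that]])
  have "quasi_affinity L K Y"
  proof (rule quasi_affinityI[OF Ylin L(1)])
    show "Y l \<in> K" if "l \<in> L" for l
      unfolding Y_def by (intro closed_csubspace_add[OF K(1)] FK K'K Y'K that)
    show "l = 0" if l: "l \<in> L" "Y l = 0" for l
    proof -
      let ?g = "X (Y' (l - E l))"
      have g: "?g \<in> L'" using Y'K[OF l(1)] by (simp add: K')
      have "X (Y l) = 0" using l(2) bounded_clinear_zero[OF X] by simp
      then have sum0: "E l + ?g = 0" by (simp add: Y_def bounded_clinear_add[OF X] XF)
      have "cinner ((M ^^ j) l) u = 0" if j: "j < Suc p" for j
      proof -
        have "cinner ((M ^^ j) l) u = cinner ((M ^^ j) (E l)) u"
          using Eu[of "(M ^^ j) l"] EMj[OF l(1), of j] by simp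
        also have "\<dots> = cinner ((M ^^ j) (E l)) u + cinner ((M ^^ j) ?g) u"
          using g j by (simp add: L')
        also have "\<dots> = cinner ((M ^^ j) (E l + ?g)) u"
          by (simp add: bounded_clinear_add[OF bounded_clinear_funpow[OF M]] cinner_add_left)
        also have "\<dots> = 0"
          unfolding sum0 by (simp add: bounded_clinear_zero[OF bounded_clinear_funpow[OF M]])
        finally show ?thesis .
      qed
      then have lL': "l \<in> L'" using l(1) by (rule L'0[rotated])
      then have "Y' l = 0" using l(2) by (simp add: Y_def F0 E0)
      then show "l = 0"
        by (rule quasi_affinity_eq_0[OF qa' cL' Y' lL'])
    qed
    show "x \<in> closure (Y ` L)" if x: "x \<in> K" for x
    proof -
      obtain g where g: "\<And>n. g n \<in> L'" "(\<lambda>n. Y' (g n)) \<longlonglongrightarrow> x - F (X x)"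
        by (rule quasi_affinity_limit[OF qa' K'I[OF x]]) (rule that)
      let ?e = "E (X x)"
      have eL: "X x - ?e \<in> L'" by (rule L'I[OF quasi_affinityD(1)[OF qa x]])
      have "F ?e = F (X x)" using F0[OF eL] by (simp add: bounded_clinear_diff[OF Flin])
      moreover have "E ?e = ?e" using E0[OF eL] by (simp add: bounded_clinear_diff[OF Elin])
      ultimately have "Y (?e + g n) = F (X x) + Y' (g n)" for n
        by (simp add: Y_def bounded_clinear_add[OF Flin] bounded_clinear_add[OF Elin] F0[OF g(1)] E0[OF g(1)])
      moreover have "(\<lambda>n. F (X x) + Y' (g n)) \<longlonglongrightarrow> F (X x) + (x - F (X x))"
        by (intro tendsto_intros g)
      ultimately have "(\<lambda>n. Y (?e + g n)) \<longlonglongrightarrow> x" by simp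
      moreover have "Y (?e + g n) \<in> Y ` L" for n
        using closed_csubspace_add[OF L(1) EL L'L[OF g(1)]] by blast
      ultimately show ?thesis by (rule closure_limitI[rotated])
    qed
  qed
  moreover have "Y (M l) = N (Y l)" if l: "l \<in> L" for l
  proof -
    have "Y (M l) = N (F l) + Y' (M (l - E l))"
      by (simp add: Y_def FM[OF l] EM[OF l] bounded_clinear_diff[OF M])
    also have "\<dots> = N (Y l)"
      by (simp add: comm'[OF L'I[OF l]] Y_def bounded_clinear_add[OF N])
    finally show ?thesis .
  qed
  ultimately show "\<exists>Y. bounded_clinear Y \<and> quasi_affinity L K Y \<and> (\<forall>l\<in>L. Y (M l) = N (Y l))"
    using Ylin by blast
qed

text \<open>
  Induction on the order \<open>m\<close> of nilpotency. If the top power of \<open>M\<close> has finite rank,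
  Jordan blocks of size \<open>m\<close> are split off on both sides until it vanishes, and \<open>m\<close> drops. If it has infinite
  rank, then so has that of \<open>N\<close>, because \<open>X\<close> has dense range, and a generic intertwiner does the job.
\<close>

theorem nilpotent_quasi_affinity_reverse:
  fixes N :: "'a::complex_hilbert \<Rightarrow> 'a" and M :: "'b::complex_hilbert \<Rightarrow> 'b"
  assumes sepa: "\<exists>C::'a set. countable C \<and> closure C = UNIV"
    and sepb: "\<exists>C::'b set. countable C \<and> closure C = UNIV"
    and N: "bounded_clinear N" and M: "bounded_clinear M" and X: "bounded_clinear X"
    and K: "closed_csubspace K" "N ` K \<subseteq> K" and L: "closed_csubspace L" "M ` L \<subseteq> L"
    and qa: "quasi_affinity K L X" and comm: "\<forall>x\<in>K. X (N x) = M (X x)"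
    and nilM: "\<forall>x\<in>L. (M ^^ m) x = 0"
  shows "\<exists>Y. bounded_clinear Y \<and> quasi_affinity L K Y \<and> (\<forall>l\<in>L. Y (M l) = N (Y l))"
  using K L qa comm nilM
proof (induction m arbitrary: K L)
  case 0
  have inj: "x = 0" if "x \<in> K" "X x = 0" for x
    by (rule quasi_affinity_eq_0[OF 0(5,1) X that])
  have "L \<subseteq> {0}" using 0(7) by auto
  then have "K \<subseteq> {0}" using inj quasi_affinityD(1)[OF 0(5)] by blast
  have "quasi_affinity L K (\<lambda>_. 0)"
    using \<open>L \<subseteq> {0}\<close> \<open>K \<subseteq> {0}\<close> closed_csubspace_0[OF 0(1)] closed_csubspace_0[OF 0(3)]
    by (intro quasi_affinityI 0 closure_subset[THEN subsetD]) (auto simp: bounded_clinear_iff)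
  then show ?case
    by (intro exI[of _ "\<lambda>_. 0"]) (auto simp: bounded_clinear_iff bounded_clinear_zero[OF N])
next
  case (Suc p)
  note Mp = bounded_clinear_funpow[OF M, of p]
  have powcomm: "X ((N ^^ j) x) = (M ^^ j) (X x)"
    if "N ` K \<subseteq> K" "\<forall>x\<in>K. X (N x) = M (X x)" "x \<in> K" for j K x
    using intertwine_funpow[of N K X M x j] that by blast
  have lower: "\<exists>Y. bounded_clinear Y \<and> quasi_affinity L K Y \<and> (\<forall>l\<in>L. Y (M l) = N (Y l))"
    if "closed_csubspace K" "N ` K \<subseteq> K" "closed_csubspace L" "M ` L \<subseteq> L" "quasi_affinity K L X"
      "\<forall>x\<in>K. X (N x) = M (X x)" "\<forall>x\<in>L. (M ^^ p) x = 0" for K L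
    using Suc.IH[OF that] .
  show ?case
  proof (cases "finite_dimensional ((M ^^ p) ` L)")
    case True
    then obtain B where B: "finite B" "(M ^^ p) ` L \<subseteq> complex_vector.span B"
      by (auto simp: finite_dimensional_def)
    have "\<forall>S. complex_vector.independent S \<longrightarrow> S \<subseteq> (M ^^ p) ` L \<longrightarrow> finite S \<and> card S \<le> card B"
      using complex_vector.independent_span_bound[OF B(1)] B(2) by blast
    then have "\<exists>r. \<forall>S. complex_vector.independent S \<longrightarrow> S \<subseteq> (M ^^ p) ` L \<longrightarrow> finite S \<and> card S \<le> r"
      by blast
    \<comment> \<open>Rank is measured by the size of independent subsets, a bound that can be used for induction
      without reference to a dimension function.\<close>
    then obtain r where "\<forall>S. complex_vector.independent S \<longrightarrow> S \<subseteq> (M ^^ p) ` L \<longrightarrow> finite S \<and> card S \<le> r"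
      by blast
    with Suc.prems show ?thesis
    proof (induction r arbitrary: K L)
      case (0 K L)
      have "(M ^^ p) l = 0" if "l \<in> L" for l
      proof (rule ccontr)
        assume "(M ^^ p) l \<noteq> 0"
        then have "complex_vector.independent {(M ^^ p) l}" by simp
        then have "card {(M ^^ p) l} \<le> 0" using 0(8) that by blast
        then show False by simp
      qed
      then show ?case using 0 by (intro lower) auto
    next
      case (Suc r K L)
      show ?case
      proof (cases "\<forall>l\<in>L. (M ^^ p) l = 0")
        case True
        then show ?thesis using Suc.prems by (intro lower) auto
      next
        case False
        then obtain l where l: "l \<in> L" "(M ^^ p) l \<noteq> 0" by blast
        obtain x where x: "\<And>n. x n \<in> K" "(\<lambda>n. X (x n)) \<longlonglongrightarrow> l"
          by (rule quasi_affinity_limit[OF Suc.prems(5) l(1)]) (rule that)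
        have "\<exists>n. (M ^^ p) (X (x n)) \<noteq> 0"
          using bounded_clinear_tendsto[OF Mp x(2)] l(2) by (metis LIMSEQ_const_iff LIMSEQ_unique ext)
        then obtain k0 where k0: "k0 \<in> K" "(M ^^ p) (X k0) \<noteq> 0" using x(1) by blast
        have nilN: "(N ^^ Suc p) x = 0" if "x \<in> K" for x
          using Suc.prems that by (intro nilpotent_pullback[OF Suc.prems(5,1) X, of N M]) auto
        have f: "bounded_clinear (\<lambda>x. cinner (X x) u)" for u
          by (rule bounded_clinear_compose[OF bounded_clinear_cinner_left X])
        define u where "u = (M ^^ p) (X k0)"
        have "\<exists>k\<in>K. \<forall>j<Suc p. cinner (X ((N ^^ j) k)) u = (if j = p then 1 else 0)"
        proof (rule dual_vector_exists[OF _ Suc.prems(2) N nilN f k0(1)])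
          show "complex_vector.subspace K" using Suc.prems(1) by (simp add: closed_csubspace_def)
          show "cinner (X ((N ^^ p) k0)) u \<noteq> 0"
            using k0(2) by (simp add: u_def powcomm[OF Suc.prems(2,6) k0(1)])
        qed
        then obtain k where k: "k \<in> K"
          "\<And>j. j < Suc p \<Longrightarrow> cinner ((M ^^ j) (X k)) u = (if j = p then 1 else 0)"
          using powcomm[OF Suc.prems(2,6)] by auto
        define L' where "L' = {l \<in> L. \<forall>j<Suc p. cinner ((M ^^ j) l) u = 0}"
        define K' where "K' = {x \<in> K. X x \<in> L'}"
        note split = cyclic_splitting[OF N M X Suc.prems(1-5) Suc.prems(6)[rule_format]
            Suc.prems(7)[rule_format] k L'_def K'_def]
        have "\<exists>Y. bounded_clinear Y \<and> quasi_affinity L' K' Y \<and> (\<forall>l\<in>L'. Y (M l) = N (Y l))"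
        proof (rule Suc.IH[OF split(1-5)])
          show "\<forall>x\<in>K'. X (N x) = M (X x)" "\<forall>x\<in>L'. (M ^^ Suc p) x = 0"
            using Suc.prems by (auto simp: K'_def L'_def)
          show "\<forall>S. complex_vector.independent S \<longrightarrow> S \<subseteq> (M ^^ p) ` L' \<longrightarrow> finite S \<and> card S \<le> r"
          proof (intro allI impI)
            fix S assume S: "complex_vector.independent S" "S \<subseteq> (M ^^ p) ` L'"
            let ?e = "(M ^^ p) (X k)"
            have "complex_vector.subspace ((M ^^ p) ` L')"
              using split(3) by (intro subspace_image[OF Mp]) (simp add: closed_csubspace_def)
            then have "complex_vector.span S \<subseteq> (M ^^ p) ` L'"
              using S(2) by (intro complex_vector.span_minimal)
            then have e: "?e \<notin> complex_vector.span S" using split(7) by blast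
            then have "complex_vector.independent (insert ?e S)"
              using S(1) by (rule complex_vector.independent_insertI)
            moreover have "insert ?e S \<subseteq> (M ^^ p) ` L"
              using S(2) split(6) by (auto simp: L'_def)
            ultimately have "finite (insert ?e S)" "card (insert ?e S) \<le> Suc r"
              using Suc.prems(8)[rule_format, of "insert ?e S"] by simp_all
            moreover have "?e \<notin> S" using e complex_vector.span_base by blast
            ultimately show "finite S \<and> card S \<le> r" by simp
          qed
        qed
        then show ?thesis using split(8) by blast
      qed
    qed
  next
    case False
    have sub: "complex_vector.subspace K" "complex_vector.subspace L"
      using Suc.prems by (auto simp: closed_csubspace_def)
    have nilN: "(N ^^ Suc p) x = 0" if "x \<in> K" for x
      using Suc.prems that by (intro nilpotent_pullback[OF Suc.prems(5,1) X, of N M]) auto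
    have infN: "\<not> finite_dimensional ((N ^^ p) ` K)"
    proof
      assume "finite_dimensional ((N ^^ p) ` K)"
      then obtain B where B: "finite B" "(N ^^ p) ` K \<subseteq> complex_vector.span B"
        by (auto simp: finite_dimensional_def)
      \<comment> \<open>A vector in the range of the top power of M that is orthogonal to the image of the range of the
        top power of N would, by density of the range of X, be orthogonal to itself.\<close>
      obtain x where x: "x \<in> (M ^^ p) ` L" "x \<noteq> 0" "\<And>b. b \<in> complex_vector.span (X ` B) \<Longrightarrow> cinner b x = 0"
        using infinite_dimensional_orthogonal[OF subspace_image[OF Mp sub(2)] False, of "X ` B"] B(1) by blast
      obtain l where l: "l \<in> L" "x = (M ^^ p) l" using x(1) by blast
      obtain k where k: "\<And>n. k n \<in> K" "(\<lambda>n. X (k n)) \<longlonglongrightarrow> l"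
        by (rule quasi_affinity_limit[OF Suc.prems(5) l(1)]) (rule that)
      have "(\<lambda>n. cinner ((M ^^ p) (X (k n))) x) \<longlonglongrightarrow> cinner x x"
        unfolding l(2) by (intro tendsto_cinner_left bounded_clinear_tendsto[OF Mp] k)
      moreover have "cinner ((M ^^ p) (X (k n))) x = 0" for n
      proof (rule x(3))
        have "X ((N ^^ p) (k n)) \<in> X ` complex_vector.span B" using B(2) k(1) by blast
        then show "(M ^^ p) (X (k n)) \<in> complex_vector.span (X ` B)"
          using span_image_subset[OF X, of B] powcomm[OF Suc.prems(2,6) k(1)] by auto
      qed
      ultimately show False using x(2) by (simp add: LIMSEQ_const_iff)
    qed
    show ?thesis
      by (rule quasi_affinity_infinite_multiplicity[OF sepa sepb N M Suc.prems(1-4) nilN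
            Suc.prems(7)[rule_format] infN False])
  qed
qed

section \<open>Quasi-similarity of the central entries\<close>

text \<open>
  With \<open>B = Q\<^sup>\<bottom>\<close>, the compressions to \<open>K\<close> and \<open>L\<close> are the operators induced by \<open>T\<close> on the quotients
  \<open>B / (P \<inter> B)\<close> and \<open>closure (P + B) / P\<close>. The inclusion of \<open>B\<close> induces a map between these quotients that
  is injective, has dense range and intertwines the induced operators; in terms of subspaces it is the
  projection onto \<open>L\<close>. Nilpotency is clear on the first quotient and passes to the second
  by density.
\<close>

proposition semi_invariant_compressions:
  fixes T :: "'a::complex_hilbert \<Rightarrow> 'a"
  assumes T: "bounded_clinear T" and P: "closed_csubspace P" "T ` P \<subseteq> P"
    and Q: "closed_csubspace Q" "T ` (UNIV \<ominus> Q) \<subseteq> UNIV \<ominus> Q"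
    and nil: "\<And>b. b \<in> UNIV \<ominus> Q \<Longrightarrow> (T ^^ n) b \<in> P"
    and K: "K = (UNIV \<ominus> Q) \<ominus> (P \<inter> (UNIV \<ominus> Q))"
    and L: "L = (UNIV \<ominus> P) \<ominus> (Q \<inter> (UNIV \<ominus> P))"
  shows "quasi_affinity K L (orth_proj L)"
    and "\<And>x. x \<in> K \<Longrightarrow> orth_proj L (compression K T x) = compression L T (orth_proj L x)"
    and "\<And>x. x \<in> K \<Longrightarrow> (compression K T ^^ n) x = 0"
    and "\<And>x. x \<in> L \<Longrightarrow> (compression L T ^^ n) x = 0"
proof -
  define B where "B = UNIV \<ominus> Q"
  have cB: "closed_csubspace B" unfolding B_def by (rule closed_csubspace_orth_diff[OF closed_csubspace_UNIV])
  have cPB: "closed_csubspace (P \<inter> B)" by (rule closed_csubspace_Int[OF P(1) cB])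
  have cK: "closed_csubspace K"
    unfolding K by (intro closed_csubspace_orth_diff closed_csubspace_UNIV)
  have cL: "closed_csubspace L"
    unfolding L by (intro closed_csubspace_orth_diff closed_csubspace_UNIV)
  note PLlin = bounded_clinear_orth_proj[OF cL]
  have KPB: "K = B \<ominus> (P \<inter> B)" by (simp add: K B_def)
  have KB: "K \<subseteq> B" by (auto simp: K B_def orth_diff_def)
  have K_orth: "cinner x a = 0" if "x \<in> K" "a \<in> P \<inter> B" for x a
    using that by (auto simp: K B_def orth_diff_def)
  have L_orth: "cinner y a = 0" if "y \<in> L" "a \<in> P" for y a
    using that by (auto simp: L orth_diff_def)
  have TB: "T x \<in> B" if "x \<in> B" for x using Q(2) that by (auto simp: B_def)
  \<comment> \<open>Modulo the intersection of P and B, every vector of B is represented by its projection onto K.\<close>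
  have BK: "b - orth_proj K b \<in> P \<inter> B" if b: "b \<in> B" for b
  proof -
    let ?a = "orth_proj (P \<inter> B) b"
    have a: "?a \<in> P \<inter> B" by (rule orth_proj_in[OF cPB])
    have "b - ?a \<in> K"
      using a b cinner_diff_orth_proj[OF cPB] closed_csubspace_diff[OF cB, of b ?a]
      unfolding KPB orth_diff_def by simp
    then have "orth_proj K b = b - ?a"
      by (rule orth_proj_eqI[OF cK]) (use K_orth a in \<open>simp add: cinner_eq_0_commute\<close>)
    then show ?thesis using a by simp
  qed
  have PL_P: "orth_proj L a = 0" if "a \<in> P" for a
    by (rule orth_proj_eq_0[OF cL]) (use L_orth that in \<open>simp add: cinner_eq_0_commute\<close>)
  \<comment> \<open>The projection onto L differs from the identity on B by a vector of P.\<close>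
  have BL: "b - orth_proj L b \<in> P" if b: "b \<in> B" for b
  proof -
    let ?a = "orth_proj P b"
    have a: "?a \<in> P" by (rule orth_proj_in[OF P(1)])
    have "cinner (b - ?a) y = 0" if "y \<in> P" for y by (rule cinner_diff_orth_proj[OF P(1) that])
    moreover have "cinner (b - ?a) q = 0" if "q \<in> Q" "q \<in> UNIV \<ominus> P" for q
    proof -
      have "cinner b q = 0" using b that(1) by (simp add: B_def orth_diff_def)
      moreover have "cinner q ?a = 0" using a that(2) by (simp add: orth_diff_def)
      ultimately show ?thesis
        using cinner_eq_0_commute[of q ?a] by (simp add: cinner_diff_left)
    qed
    ultimately have "b - ?a \<in> L" by (simp add: L orth_diff_def)
    then have "orth_proj L b = b - ?a"
      by (rule orth_proj_eqI[OF cL]) (use L_orth a in \<open>simp add: cinner_eq_0_commute\<close>)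
    then show ?thesis using a by simp
  qed
  show "quasi_affinity K L (orth_proj L)"
  proof (rule quasi_affinityI[OF PLlin cK])
    show "orth_proj L x \<in> L" for x by (rule orth_proj_in[OF cL])
    show "x = 0" if x: "x \<in> K" "orth_proj L x = 0" for x
    proof -
      have "x \<in> P \<inter> B" using BL[of x] x KB by auto
      then show ?thesis using K_orth[OF x(1), of x] by simp
    qed
    have "L \<subseteq> closure (orth_proj L ` K)"
    proof (rule dense_if_no_orthogonal[OF cL])
      show "complex_vector.subspace (orth_proj L ` K)"
        using cK by (intro subspace_image[OF PLlin]) (simp add: closed_csubspace_def)
      show "orth_proj L ` K \<subseteq> L" using orth_proj_in[OF cL] by blast
      fix y assume y: "y \<in> L" and orth: "\<And>s. s \<in> orth_proj L ` K \<Longrightarrow> cinner y s = 0"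
      have yK: "cinner y k = 0" if "k \<in> K" for k
        using orth[of "orth_proj L k"] that cinner_orth_proj[OF cL y, of k]
          cinner_eq_0_commute[of y k] cinner_eq_0_commute[of y "orth_proj L k"] by simp
      have yB: "cinner y b = 0" if b: "b \<in> B" for b
      proof -
        have "cinner y (b - orth_proj K b) = 0"
          using L_orth[OF y] BK[OF b] by blast
        then show ?thesis using yK[OF orth_proj_in[OF cK, of b]] by (simp add: cinner_diff_right)
      qed
      \<comment> \<open>A vector orthogonal to B is in the double orthogonal complement of Q, that is in Q.\<close>
      let ?q = "orth_proj Q y"
      have d: "y - ?q \<in> B"
        using cinner_diff_orth_proj[OF Q(1)] by (auto simp: B_def orth_diff_def)
      have "cinner ?q (y - ?q) = 0"
        using cinner_diff_orth_proj[OF Q(1) orth_proj_in[OF Q(1)], of y y]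
          cinner_eq_0_commute[of ?q "y - ?q"] by blast
      then have "cinner (y - ?q) (y - ?q) = 0"
        using yB[OF d] by (subst cinner_diff_left) simp
      then have "y \<in> Q" using orth_proj_in[OF Q(1), of y] by simp
      moreover have "y \<in> UNIV \<ominus> P" using y by (auto simp: L orth_diff_def)
      ultimately have "cinner y y = 0" using y by (auto simp: L orth_diff_def)
      then show "y = 0" by simp
    qed
    then show "y \<in> closure (orth_proj L ` K)" if "y \<in> L" for y using that by blast
  qed
  show inter: "orth_proj L (compression K T x) = compression L T (orth_proj L x)" if x: "x \<in> K" for x
  proof -
    have xB: "x \<in> B" using x KB by blast
    have "orth_proj L (T x - orth_proj K (T x)) = 0"
      using BK[OF TB[OF xB]] by (intro PL_P) blast
    moreover have "orth_proj L (T (x - orth_proj L x)) = 0"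
      using BL[OF xB] P(2) by (intro PL_P) blast
    ultimately show ?thesis
      by (simp add: compression_def bounded_clinear_diff[OF PLlin] bounded_clinear_diff[OF T])
  qed
  have TPB: "T a \<in> P \<inter> B" if "a \<in> P \<inter> B" for a using that P(2) TB by blast
  have NK: "compression K T x \<in> K" for x by (simp add: compression_def orth_proj_in[OF cK])
  have NL: "compression L T x \<in> L" for x by (simp add: compression_def orth_proj_in[OF cL])
  show nilK: "(compression K T ^^ n) x = 0" if x: "x \<in> K" for x
  proof -
    have "(T ^^ k) x \<in> B \<and> (compression K T ^^ k) x \<in> K \<and> (T ^^ k) x - (compression K T ^^ k) x \<in> P \<inter> B" for k
    proof (induction k)
      case 0
      show ?case using x KB closed_csubspace_0[OF cPB] by auto
    next
      case (Suc k)
      let ?N = "(compression K T ^^ k) x"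
      have "T ((T ^^ k) x - ?N) \<in> P \<inter> B" using Suc by (intro TPB) blast
      moreover have "T ?N - compression K T ?N \<in> P \<inter> B"
      proof -
        have "?N \<in> B" using Suc KB by auto
        from BK[OF TB[OF this]] show ?thesis by (simp only: compression_def)
      qed
      ultimately have "T ((T ^^ k) x - ?N) + (T ?N - compression K T ?N) \<in> P \<inter> B"
        by (rule closed_csubspace_add[OF cPB])
      then have "(T ^^ Suc k) x - (compression K T ^^ Suc k) x \<in> P \<inter> B"
        by (simp add: bounded_clinear_diff[OF T])
      moreover have "(T ^^ Suc k) x \<in> B" using Suc TB by simp
      moreover have "(compression K T ^^ Suc k) x \<in> K" using NK by simp
      ultimately show ?case by blast
    qed
    from this[of n] have 1: "(compression K T ^^ n) x \<in> K"
      and 2: "(T ^^ n) x - (compression K T ^^ n) x \<in> P \<inter> B" and 3: "(T ^^ n) x \<in> P \<inter> B"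
      using nil[of x] x KB unfolding B_def by auto
    have "(compression K T ^^ n) x \<in> P \<inter> B"
      using closed_csubspace_diff[OF cPB 3 2] by simp
    then show ?thesis using K_orth[OF 1] by (metis cinner_self_eq_0_iff)
  qed
  show "(compression L T ^^ n) y = 0" if y: "y \<in> L" for y
  proof -
    have lin: "bounded_clinear (compression L T)"
      unfolding compression_def[abs_def] by (rule bounded_clinear_compose[OF PLlin T])
    obtain x where x: "\<And>i. x i \<in> K" "(\<lambda>i. orth_proj L (x i)) \<longlonglongrightarrow> y"
      by (rule quasi_affinity_limit[OF \<open>quasi_affinity K L (orth_proj L)\<close> y]) (rule that)
    have "(\<lambda>i. (compression L T ^^ n) (orth_proj L (x i))) \<longlonglongrightarrow> (compression L T ^^ n) y"
      by (rule bounded_clinear_tendsto[OF bounded_clinear_funpow[OF lin] x(2)])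
    moreover have "(compression L T ^^ n) (orth_proj L (x i)) = 0" for i
    proof -
      have "orth_proj L ((compression K T ^^ n) (x i)) = (compression L T ^^ n) (orth_proj L (x i))"
        by (rule intertwine_funpow[where X = "orth_proj L" and M = "compression L T" and K = K])
           (use NK inter x in auto)
      then show ?thesis using nilK[OF x(1)] bounded_clinear_zero[OF PLlin] by simp
    qed
    ultimately show ?thesis by (simp add: LIMSEQ_const_iff)
  qed
qed

theorem theorem5p2:
  fixes T :: "'a::complex_hilbert \<Rightarrow> 'a" and n :: nat
    and M1 Mm1 H1 H0 Hm1 H1s H0s Hm1s H00 H0s0 :: "'a set"
    and N0 Ns0 :: "'a \<Rightarrow> 'a"
  assumes separable: "separable_space (euclidean :: 'a topology)"
    and contraction: "contraction T"
    and cnu: "completely_non_unitary T"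
    and poly: "operator_polynomial (defect_space T) (defect_star_space T) n (char_fun T)"
    and M1: "M1 = isometric_part T"
    and Mm1: "Mm1 = isometric_part (cadjoint T)"
    and H1: "H1 = orbit_span T (defect_star_space T) n"
    and Hm1: "Hm1 = Mm1"
    and H0: "H0 = UNIV \<ominus> {x + y |x y. x \<in> H1 \<and> y \<in> Hm1}"
    and H1s: "H1s = M1"
    and Hm1s: "Hm1s = orbit_span (cadjoint T) (defect_space T) n"
    and H0s: "H0s = UNIV \<ominus> {x + y |x y. x \<in> H1s \<and> y \<in> Hm1s}"
    and H00: "H00 = H0 \<ominus> (M1 \<inter> H0)"
    and H0s0: "H0s0 = H0s \<ominus> (H0s \<inter> Mm1)"
    and N0: "N0 = compression H00 T"
    and Ns0: "Ns0 = compression H0s0 T"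
  shows "nilpotent_on H00 N0 \<and> nilpotent_on H0s0 Ns0 \<and> quasi_similar H00 N0 H0s0 Ns0"
proof -
  note T = contraction
  note Ts = contraction_cadjoint[OF T] and TT = cadjoint_cadjoint[OF T]
  have lin: "bounded_clinear T" by (rule contraction_bounded_clinear[OF T])
  have sep: "\<exists>C::'a set. countable C \<and> closure C = UNIV"
    using separable by (auto simp: separable_space_def)
  have van: "defect T ((T ^^ k) (defect (cadjoint T) y)) = 0" if "n \<le> k" for k y
    using defect_funpow_defect_star_eq_0[OF T poly that] by (simp add: defect_star_eq[OF T])
  have vans: "defect (cadjoint T) ((cadjoint T ^^ k) (defect (cadjoint (cadjoint T)) y)) = 0"
    if "n \<le> k" for k y
    using defect_star_funpow_defect_eq_0[OF T van[OF that]] by (simp add: TT)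
  have cM1: "closed_csubspace M1" and cMm1: "closed_csubspace Mm1"
    unfolding M1 Mm1 by (rule isometric_part_maximal(1)[OF T] isometric_part_maximal(1)[OF Ts])+
  have cH1: "closed_csubspace H1" and cHm1s: "closed_csubspace Hm1s"
    unfolding H1 Hm1s by (simp_all add: orbit_span_def closed_csubspace_closure)
  have Ds: "defect_star_space (cadjoint T) = defect_space T"
    by (simp add: defect_star_space_eq[OF Ts] TT)
  have H1M1: "H1 \<subseteq> M1"
    unfolding H1 M1 by (rule orbit_span_subset_isometric_part[OF T van])
  have H1Mm1: "cinner h q = 0" if "h \<in> H1" "q \<in> Mm1" for h q
    using that unfolding H1 Mm1 by (rule orbit_span_orthogonal[OF T])
  have Hm1sMm1: "Hm1s \<subseteq> Mm1"
    using orbit_span_subset_isometric_part[OF Ts vans] by (simp add: Hm1s Mm1 Ds)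
  have Hm1sM1: "cinner h q = 0" if "h \<in> Hm1s" "q \<in> M1" for h q
    using orbit_span_orthogonal[OF Ts, of h n q] that by (simp add: Hm1s M1 Ds TT)
  have sum_orth: "x \<in> UNIV \<ominus> {a + b |a b. a \<in> A \<and> b \<in> B} \<longleftrightarrow>
      (\<forall>a\<in>A. cinner x a = 0) \<and> (\<forall>b\<in>B. cinner x b = 0)"
    if "closed_csubspace A" "closed_csubspace B" for A B and x :: 'a
    using closed_csubspace_0[OF that(1)] closed_csubspace_0[OF that(2)]
    by (fastforce simp: orth_diff_def cinner_add_right)
  have K: "H00 = (UNIV \<ominus> Mm1) \<ominus> (M1 \<inter> (UNIV \<ominus> Mm1))"
    unfolding H00
    by (rule central_space_eq[OF cM1 cH1 H1M1 H1Mm1]) (simp_all add: H0 Hm1 sum_orth[OF cH1 cMm1])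
  have L: "H0s0 = (UNIV \<ominus> M1) \<ominus> (Mm1 \<inter> (UNIV \<ominus> M1))"
    unfolding H0s0 Int_commute[of H0s]
    by (rule central_space_eq[OF cMm1 cHm1s Hm1sMm1 Hm1sM1])
       (auto simp: H0s H1s sum_orth[OF cM1 cHm1s])
  have TM1: "T ` M1 \<subseteq> M1" unfolding M1 by (rule isometric_part_maximal(2)[OF T])
  have "cadjoint T ` Mm1 \<subseteq> Mm1" unfolding Mm1 by (rule isometric_part_maximal(2)[OF Ts])
  then have TB: "T ` (UNIV \<ominus> Mm1) \<subseteq> UNIV \<ominus> Mm1"
    by (auto simp: orth_diff_def cinner_cadjoint[OF lin])
  have nil: "(T ^^ n) b \<in> M1" if "b \<in> UNIV \<ominus> Mm1" for b
    unfolding M1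
    by (rule funpow_in_isometric_part[OF T van]) (use that in \<open>auto simp: orth_diff_def Mm1\<close>)
  note comp = semi_invariant_compressions[OF lin cM1 TM1 cMm1 TB nil K L]
  have cK: "closed_csubspace H00" and cL: "closed_csubspace H0s0"
    unfolding K L by (intro closed_csubspace_orth_diff closed_csubspace_UNIV)+
  have "\<exists>Y. bounded_clinear Y \<and> quasi_affinity H0s0 H00 Y \<and> (\<forall>l\<in>H0s0. Y (Ns0 l) = N0 (Y l))"
  proof (rule nilpotent_quasi_affinity_reverse[OF sep sep])
    show "bounded_clinear N0" "bounded_clinear Ns0" "bounded_clinear (orth_proj H0s0)"
      unfolding N0 Ns0 compression_def[abs_def]
      by (intro bounded_clinear_compose[OF bounded_clinear_orth_proj[OF cK] lin]
          bounded_clinear_compose[OF bounded_clinear_orth_proj[OF cL] lin]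
          bounded_clinear_orth_proj[OF cL])+
    show "N0 ` H00 \<subseteq> H00" "Ns0 ` H0s0 \<subseteq> H0s0"
      using orth_proj_in[OF cK] orth_proj_in[OF cL] by (auto simp: N0 Ns0 compression_def)
    show "quasi_affinity H00 H0s0 (orth_proj H0s0)" by (rule comp(1))
    show "\<forall>x\<in>H00. orth_proj H0s0 (N0 x) = Ns0 (orth_proj H0s0 x)"
      using comp(2) by (simp add: N0 Ns0)
    show "\<forall>x\<in>H0s0. (Ns0 ^^ n) x = 0" using comp(4) by (simp add: Ns0)
  qed (rule cK cL)+
  then have "quasi_similar H00 N0 H0s0 Ns0"
    unfolding quasi_similar_def using comp(1,2) by (auto simp: N0 Ns0)
  then show ?thesis
    using comp(3,4) by (auto simp: nilpotent_on_def N0 Ns0)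
qed

end
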